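(* The language $\mathbf{USSR}$ belongs to the complexity class $\mathbf{P}/\mathbf{poly}$.
   Context: $\mathbf{USSR}$ (unary sum of square roots) is the following decision problem. An instance consists of a positive integer $k$, positive integers $a_1,\dots,a_k$ with $1 \le a_i \le k$ for all $i$, and signs $\delta_1,\dots,\delta_k \in \{-1,1\}$; the numbers are given in unary, so an instance has size polynomial in $k$. The instance is a yes-instance if and only if $\sum_{i=1}^k \delta_i \sqrt{a_i} > 0$. $\mathbf{P}/\mathbf{poly}$ is the class of languages decidable by a polynomial-time Turing machine that, on inputs of length $n$, is also given an advice string depending only on $n$ and of length polynomial in $n$. *)

theory Defs
  imports Complex_Main "HOL-Computational_Algebra.Polynomial"
begin

section \<open>Deterministic multi-tape Turing machines\<close>

text \<open>
  States are the numbers below \<open>num_states\<close>, tape symbols the numbers below \<open>num_symbols\<close>.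
  Symbol 0 is the blank; symbols 1 and 2 represent the input bits 0 and 1.  Tapes are infinite
  in both directions.
\<close>

datatype move = MoveLeft | Stay | MoveRight

record tm =
  num_tapes :: nat
  num_states :: nat
  num_symbols :: nat
  start_state :: nat
  accept_state :: nat
  reject_state :: nat
  trans :: "nat \<Rightarrow> nat list \<Rightarrow> nat \<times> (nat \<times> move) list"

definition wf_tm :: "tm \<Rightarrow> bool" where
  "wf_tm M \<longleftrightarrow>
     num_tapes M \<ge> 2 \<and> num_symbols M \<ge> 3 \<and>
     start_state M < num_states M \<and>
     accept_state M < num_states M \<and>
     reject_state M < num_states M \<and>
     accept_state M \<noteq> reject_state M \<and>
     (\<forall>q ss q' acts.
        q < num_states M \<and> length ss = num_tapes M \<and> (\<forall>s\<in>set ss. s < num_symbols M) \<and>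
        trans M q ss = (q', acts) \<longrightarrow>
          q' < num_states M \<and> length acts = num_tapes M \<and>
          (\<forall>(s, m)\<in>set acts. s < num_symbols M))"

text \<open>A tape is its content together with the head position.\<close>

type_synonym tape = "(int \<Rightarrow> nat) \<times> int"
type_synonym tm_config = "nat \<times> tape list"

fun read_tape :: "tape \<Rightarrow> nat" where
  "read_tape (f, h) = f h"

fun move_head :: "move \<Rightarrow> int \<Rightarrow> int" where
  "move_head MoveLeft h = h - 1"
| "move_head Stay h = h"
| "move_head MoveRight h = h + 1"

fun act_tape :: "nat \<times> move \<Rightarrow> tape \<Rightarrow> tape" where
  "act_tape (s, m) (f, h) = (f(h := s), move_head m h)"

fun tm_step :: "tm \<Rightarrow> tm_config \<Rightarrow> tm_config" where
  "tm_step M (q, ts) =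
     (if q = accept_state M \<or> q = reject_state M then (q, ts)
      else let (q', acts) = trans M q (map read_tape ts) in (q', map2 act_tape acts ts))"

definition bits_tape :: "bool list \<Rightarrow> tape" where
  "bits_tape x =
     (\<lambda>i. if 0 \<le> i \<and> i < int (length x) then (if x ! nat i then 2 else 1) else 0, 0)"

definition blank_tape :: tape where
  "blank_tape = (\<lambda>_. 0, 0)"

text \<open>The input is on the first tape, the advice string on the second.\<close>

definition tm_init :: "tm \<Rightarrow> bool list \<Rightarrow> bool list \<Rightarrow> tm_config" where
  "tm_init M x y =
     (start_state M, [bits_tape x, bits_tape y] @ replicate (num_tapes M - 2) blank_tape)"

definition tm_accepts_within :: "tm \<Rightarrow> bool list \<Rightarrow> bool list \<Rightarrow> nat \<Rightarrow> bool" where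
  "tm_accepts_within M x y T \<longleftrightarrow>
     (\<exists>t\<le>T. fst ((tm_step M ^^ t) (tm_init M x y)) = accept_state M)"

definition tm_rejects_within :: "tm \<Rightarrow> bool list \<Rightarrow> bool list \<Rightarrow> nat \<Rightarrow> bool" where
  "tm_rejects_within M x y T \<longleftrightarrow>
     (\<exists>t\<le>T. fst ((tm_step M ^^ t) (tm_init M x y)) = reject_state M)"


section \<open>The class P/poly\<close>

definition P_poly :: "bool list set set" where
  "P_poly =
     {L. \<exists>(M :: tm) (p :: nat poly) (q :: nat poly) (adv :: nat \<Rightarrow> bool list).
           wf_tm M \<and>
           (\<forall>n. length (adv n) \<le> poly q n) \<and>
           (\<forall>x. if x \<in> L
                then tm_accepts_within M x (adv (length x)) (poly p (length x))
                else tm_rejects_within M x (adv (length x)) (poly p (length x)))}"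


section \<open>Unary sum of square roots\<close>

definition ussr_instance :: "nat \<Rightarrow> (nat \<Rightarrow> nat) \<Rightarrow> (nat \<Rightarrow> int) \<Rightarrow> bool" where
  "ussr_instance k a \<delta> \<longleftrightarrow>
     k \<ge> 1 \<and> (\<forall>i\<in>{1..k}. 1 \<le> a i \<and> a i \<le> k \<and> \<delta> i \<in> {-1, 1})"

text \<open>
  The word \<open>1\<^sup>k 0 s\<^sub>1 1\<^bsup>a\<^sub>1\<^esup> 0 \<dots> s\<^sub>k 1\<^bsup>a\<^sub>k\<^esup> 0\<close>, where the bit \<open>s\<^sub>i\<close> is 1 iff the \<open>i\<close>-th sign is positive.
\<close>

definition ussr_encode :: "nat \<Rightarrow> (nat \<Rightarrow> nat) \<Rightarrow> (nat \<Rightarrow> int) \<Rightarrow> bool list" where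
  "ussr_encode k a \<delta> =
     replicate k True @ [False] @
     concat (map (\<lambda>i. [\<delta> i = 1] @ replicate (a i) True @ [False]) [1..<Suc k])"

definition USSR :: "bool list set" where
  "USSR = {ussr_encode k a \<delta> | k a \<delta>.
     ussr_instance k a \<delta> \<and> (\<Sum>i = 1..k. real_of_int (\<delta> i) * sqrt (real (a i))) > 0}"

lemma unary_block_inject:
  "replicate m True @ False # xs = replicate n True @ False # ys \<longleftrightarrow> m = n \<and> xs = ys"
proof (induction m arbitrary: n)
  case 0
  then show ?case by (cases n) auto
next
  case (Suc m)
  then show ?case by (cases n) auto
qed

lemma ussr_blocks_inject:
  assumes "concat (map (\<lambda>i. [\<delta> i = 1] @ replicate (a i) True @ [False]) is) =
           concat (map (\<lambda>i. [\<delta>' i = 1] @ replicate (a' i) True @ [False]) is)"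
    and "i \<in> set is"
  shows "a i = a' i \<and> (\<delta> i = (1 :: int) \<longleftrightarrow> \<delta>' i = (1 :: int))"
  using assms by (induction "is") (auto simp: unary_block_inject)

lemma ussr_encode_inject:
  assumes "ussr_instance k a \<delta>" "ussr_instance k' a' \<delta>'"
    and "ussr_encode k a \<delta> = ussr_encode k' a' \<delta>'"
  shows "k = k' \<and> (\<forall>i\<in>{1..k}. a i = a' i \<and> \<delta> i = \<delta>' i)"
proof -
  have k: "k = k'"
    and eq: "concat (map (\<lambda>i. [\<delta> i = 1] @ replicate (a i) True @ [False]) [1..<Suc k]) =
             concat (map (\<lambda>i. [\<delta>' i = 1] @ replicate (a' i) True @ [False]) [1..<Suc k])"
    using assms(3) unfolding ussr_encode_def by (auto simp: unary_block_inject simp del: upt_Suc)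
  show ?thesis
  proof (intro conjI ballI k)
    fix i assume i: "i \<in> {1..k}"
    then have "i \<in> set [1..<Suc k]" by auto
    from ussr_blocks_inject[OF eq this]
    have *: "a i = a' i" "\<delta> i = 1 \<longleftrightarrow> \<delta>' i = 1" by auto
    show "a i = a' i" by (rule *)
    show "\<delta> i = \<delta>' i"
      using assms(1,2) i k *(2) unfolding ussr_instance_def by fastforce
  qed
qed

lemma ussr_encode_in_USSR_iff:
  assumes "ussr_instance k a \<delta>"
  shows "ussr_encode k a \<delta> \<in> USSR \<longleftrightarrow>
           (\<Sum>i = 1..k. real_of_int (\<delta> i) * sqrt (real (a i))) > 0"
proof
  assume "ussr_encode k a \<delta> \<in> USSR"
  then obtain k' a' \<delta>' where inst: "ussr_instance k' a' \<delta>'"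
    and eq: "ussr_encode k a \<delta> = ussr_encode k' a' \<delta>'"
    and pos: "(\<Sum>i = 1..k'. real_of_int (\<delta>' i) * sqrt (real (a' i))) > 0"
    unfolding USSR_def by auto
  have inj: "k = k'" "\<And>i. i \<in> {1..k} \<Longrightarrow> a i = a' i \<and> \<delta> i = \<delta>' i"
    using ussr_encode_inject[OF assms inst eq] by auto
  have "(\<Sum>i = 1..k. real_of_int (\<delta> i) * sqrt (real (a i))) =
        (\<Sum>i = 1..k'. real_of_int (\<delta>' i) * sqrt (real (a' i)))"
    using inj by (intro sum.cong) auto
  with pos show "(\<Sum>i = 1..k. real_of_int (\<delta> i) * sqrt (real (a i))) > 0" by simp
next
  assume "(\<Sum>i = 1..k. real_of_int (\<delta> i) * sqrt (real (a i))) > 0"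
  with assms show "ussr_encode k a \<delta> \<in> USSR" unfolding USSR_def by blast
qed

end

theory Submission
  imports Defs "HOL-Analysis.Kronecker_Approximation_Theorem"
begin

text \<open>
  An instance of input length \<open>n\<close> only asks for the sign of \<open>\<Sum> c\<^sub>b \<surd>b\<close>, where \<open>c\<close> is an integer
  vector of \<open>1\<close>-norm at most \<open>n\<close> and \<open>b \<le> n\<close>.  By the rounding technique of Frank and Tardos (iterated
  simultaneous Diophantine approximation) there are natural numbers \<open>w\<^sub>b\<close> with polynomially many bits
  such that \<open>\<Sum> c\<^sub>b w\<^sub>b\<close> has the same sign as \<open>\<Sum> c\<^sub>b \<surd>b\<close> for all these \<open>c\<close> at once.  The advice
  consists of the increments \<open>w\<^sub>b\<^sub>+\<^sub>1 - w\<^sub>b \<ge> 0\<close> in binary, so that a machine reading \<open>a\<^sub>i\<close> in unary adds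
  one increment per symbol and never has to look up an entry.
\<close>

section \<open>Integer weights with the signs of square roots\<close>

text \<open>Simply truncating the square roots runs into an obstacle: the classical lower bound for
  a nonzero signed sum of \<open>k\<close> square roots comes from a product over up to
  \<open>2^k\<close> conjugates and leaves room for values whose binary expansion starts only after
  exponentially many zeros. Such weights exist for every real vector, and existence is enough, since
  advice need not be computable. About square roots, only \<open>sqrt 0 = 0\<close> and monotonicity
  enter, and they make the increments nonnegative and let them telescope. One round of rounding
  costs a factor of about \<open>(2 * N) ^ d\<close> with \<open>N\<close> and \<open>d\<close>
  linear in the input length, and there are at most \<open>d\<close> rounds; a generous estimate
  turns this into cubically many bits.\<close>

lemma sgn_add_dominant:
  fixes a b :: "'a::linordered_idom"
  assumes "\<bar>b\<bar> < \<bar>a\<bar>"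
  shows "sgn (a + b) = sgn a"
  using assms by (auto simp: sgn_if abs_if split: if_splits)

lemma abs_sum_mult_le:
  fixes c x :: "'i \<Rightarrow> 'a::linordered_idom"
  assumes "\<And>i. i \<in> S \<Longrightarrow> \<bar>x i\<bar> \<le> B"
  shows "\<bar>\<Sum>i\<in>S. c i * x i\<bar> \<le> (\<Sum>i\<in>S. \<bar>c i\<bar>) * B"
proof -
  have "\<bar>\<Sum>i\<in>S. c i * x i\<bar> \<le> (\<Sum>i\<in>S. \<bar>c i * x i\<bar>)"
    by (rule sum_abs)
  also have "\<dots> \<le> (\<Sum>i\<in>S. \<bar>c i\<bar> * B)"
    using assms by (intro sum_mono) (simp add: abs_mult mult_left_mono)
  finally show ?thesis
    by (simp add: sum_distrib_right)
qed

text \<open>The induction is over the number of nonzero entries, because each round of approximation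
  annihilates at least one of them. The dimension \<open>d\<close> stays fixed, so every round
  contributes the same factor to the bound.\<close>

lemma sign_preserving_rounding_aux:
  fixes w :: "nat \<Rightarrow> real" and N d m :: nat
  assumes N: "N > 0" and "card {i. i < d \<and> w i \<noteq> 0} \<le> m"
  shows "\<exists>p :: nat \<Rightarrow> int.
           (\<forall>i<d. \<bar>p i\<bar> < int (N * (2 * N) ^ d + 1) ^ m) \<and>
           (\<forall>c. (\<Sum>i<d. \<bar>c i\<bar>) \<le> int N \<longrightarrow>
              sgn (\<Sum>i<d. of_int (c i) * w i) = of_int (sgn (\<Sum>i<d. c i * p i)))"
  using assms(2)
proof (induction m arbitrary: w)
  case 0
  then have "\<forall>i<d. w i = 0" by auto
  then show ?case by (intro exI[of _ "\<lambda>_. 0"]) simp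
next
  case (Suc m)
  define Q where "Q = (2 * N) ^ d"
  define D where "D = int (N * Q + 1)"
  have D1: "D \<ge> 1" by (simp add: D_def)
  show ?case
  proof (cases "\<exists>i<d. w i \<noteq> 0")
    case False
    moreover have "0 < D ^ Suc m" using D1 by simp
    ultimately show ?thesis
      unfolding D_def Q_def by (intro exI[of _ "\<lambda>_. 0"]) (simp del: power_Suc)
  next
    case True
    txt \<open>
      Scale \<open>w\<close> to maximum norm \<open>1\<close> and approximate \<open>q w\<close> by an integer vector \<open>p\<close>.  The entry of
      modulus \<open>1\<close> is hit exactly, so the remainder \<open>r = q w - p\<close> has fewer nonzero entries.  If
      \<open>c \<cdot> p \<noteq> 0\<close>, it decides the sign of \<open>c \<cdot> w\<close>; otherwise \<open>c \<cdot> r\<close> does.  The weight \<open>M\<close> below makes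
      \<open>M p + p'\<close> perform this lexicographic comparison.
    \<close>
    define s where "s = Max ((\<lambda>i. \<bar>w i\<bar>) ` {..<d})"
    have ne: "(\<lambda>i. \<bar>w i\<bar>) ` {..<d} \<noteq> {}" using True by auto
    have "s \<in> (\<lambda>i. \<bar>w i\<bar>) ` {..<d}"
      unfolding s_def using ne by (intro Max_in) auto
    then obtain z where z: "z < d" "s = \<bar>w z\<bar>" by auto
    have s: "\<bar>w i\<bar> \<le> s" if "i < d" for i
      unfolding s_def using that by (intro Max_ge) auto
    have s0: "s > 0" using True s by (metis abs_le_zero_iff linorder_not_le order.trans)
    have "2 * N > 0" using N by simp
    from Dirichlet_approx_simult[OF this, of d "\<lambda>i. w i / s"]
    obtain q p where q: "0 < q" "q \<le> int Q"
      and p: "\<And>i. i < d \<Longrightarrow> \<bar>of_int q * (w i / s) - of_int (p i)\<bar> < 1 / real (2 * N)"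
      unfolding Q_def by blast
    define r where "r i = of_int q * (w i / s) - of_int (p i)" for i
    have r: "\<bar>r i\<bar> < 1 / real (2 * N)" if "i < d" for i
      using p[OF that] by (simp add: r_def)
    have small: "1 / real (2 * N) < 1" using N by simp
    \<comment> \<open>Two integers at distance below \<open>1\<close> coincide. Besides the entry of
      maximal modulus this covers the zero entries of \<open>w\<close>, so the remainder acquires no
      new nonzero entry.\<close>
    have zero: "r i = 0" if "i < d" "of_int q * (w i / s) = of_int j" for i j
    proof -
      have "\<bar>real_of_int (j - p i)\<bar> < 1"
        using r[OF that(1)] small unfolding r_def that(2) by simp
      then have "j = p i" by linarith
      then show ?thesis unfolding r_def that(2) by simp
    qed
    have r0: "r i = 0" if "i < d" "w i = 0" for i
      using zero[OF that(1), of 0] that(2) by simp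
    have "w z / s = 1 \<or> w z / s = - 1" using z(2) s0 by (auto simp: abs_if split: if_splits)
    then have "of_int q * (w z / s) = of_int q \<or> of_int q * (w z / s) = of_int (- q)"
      by (metis mult.right_neutral mult_minus_right of_int_minus)
    then have rz: "r z = 0"
      using zero[OF z(1)] by blast
    have "card {i. i < d \<and> r i \<noteq> 0} < card {i. i < d \<and> w i \<noteq> 0}"
    proof (rule psubset_card_mono)
      have "z \<in> {i. i < d \<and> w i \<noteq> 0}" using z s0 by auto
      then show "{i. i < d \<and> r i \<noteq> 0} \<subset> {i. i < d \<and> w i \<noteq> 0}"
        using r0 rz by blast
    qed simp
    then have "card {i. i < d \<and> r i \<noteq> 0} \<le> m" using Suc.prems by simp
    from Suc.IH[OF this, folded Q_def, folded D_def] obtain p' where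
      p': "\<And>i. i < d \<Longrightarrow> \<bar>p' i\<bar> < D ^ m" and
      sg: "\<And>c. (\<Sum>i<d. \<bar>c i\<bar>) \<le> int N \<Longrightarrow>
              sgn (\<Sum>i<d. of_int (c i) * r i) = of_int (sgn (\<Sum>i<d. c i * p' i))"
      by blast
    have pq: "\<bar>p i\<bar> \<le> q" if "i < d" for i
    proof -
      have "\<bar>w i / s\<bar> \<le> 1" using s[OF that] s0 by (simp add: abs_div)
      then have "\<bar>of_int q * (w i / s)\<bar> \<le> of_int q"
        using q(1) unfolding abs_mult by (simp add: mult_left_le del: abs_divide)
      then have "\<bar>real_of_int (p i)\<bar> < of_int q + 1"
        using abs_triangle_ineq4[of "of_int q * (w i / s)" "r i"] r[OF that] small
        by (simp add: r_def)
      then show ?thesis by linarith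
    qed
    \<comment> \<open>The entries of \<open>p'\<close> have modulus at most
      \<open>D ^ m - 1\<close>, so \<open>M\<close> exceeds every possible value of
      \<open>c \<cdot> p'\<close>. Since \<open>M \<le> N * D ^ m\<close> and \<open>p\<close> is
      bounded by \<open>Q\<close>, the combined entries stay below
      \<open>(N * Q + 1) * D ^ m\<close>, which explains the choice of \<open>D\<close>.\<close>
    define M where "M = int N * (D ^ m - 1) + 1"
    have Dm: "D ^ m \<ge> 1" using D1 by simp
    have M1: "M \<ge> 1" using Dm by (simp add: M_def)
    show ?thesis
    proof (intro exI[of _ "\<lambda>i. M * p i + p' i"] conjI allI impI)
      fix i assume i: "i < d"
      have "\<bar>M * p i + p' i\<bar> \<le> M * \<bar>p i\<bar> + \<bar>p' i\<bar>"
        using abs_triangle_ineq[of "M * p i" "p' i"] M1 by (simp add: abs_mult)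
      also have "\<dots> < M * int Q + D ^ m"
        using pq[OF i] q(2) p'[OF i] M1 by (intro add_le_less_mono mult_left_mono) auto
      also have "\<dots> \<le> int N * D ^ m * int Q + D ^ m"
        using N Dm by (intro add_right_mono mult_right_mono) (auto simp: M_def algebra_simps)
      also have "\<dots> = D ^ Suc m" by (simp add: D_def algebra_simps)
      finally show "\<bar>M * p i + p' i\<bar> < int (N * (2 * N) ^ d + 1) ^ Suc m"
        by (simp only: D_def Q_def)
    next
      fix c assume c: "(\<Sum>i<d. \<bar>c i\<bar>) \<le> int N"
      define W R P P' where "W = (\<Sum>i<d. of_int (c i) * w i)"
        and "R = (\<Sum>i<d. of_int (c i) * r i)"
        and "P = (\<Sum>i<d. c i * p i)" and "P' = (\<Sum>i<d. c i * p' i)"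
      have "of_int q / s * W = of_int P + R"
        unfolding W_def P_def R_def r_def
        by (simp add: sum_distrib_left sum.distrib[symmetric] algebra_simps)
      moreover have "sgn (of_int q / s * W) = sgn W"
        using q(1) s0 by (simp add: sgn_mult)
      ultimately have W: "sgn W = sgn (of_int P + R)" by simp
      have cR: "(\<Sum>i<d. \<bar>real_of_int (c i)\<bar>) \<le> real N"
        using c by (metis (mono_tags, lifting) of_int_abs of_int_le_iff of_int_of_nat_eq of_int_sum sum.cong)
      have "\<bar>R\<bar> \<le> (\<Sum>i<d. \<bar>real_of_int (c i)\<bar>) * (1 / real (2 * N))"
        unfolding R_def using r by (intro abs_sum_mult_le) (auto intro: less_imp_le)
      also have "\<dots> \<le> real N * (1 / real (2 * N))"
        using cR by (intro mult_right_mono) auto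
      also have "\<dots> < 1" using N by simp
      finally have R: "\<bar>R\<bar> < 1" .
      have "\<bar>P'\<bar> \<le> (\<Sum>i<d. \<bar>c i\<bar>) * (D ^ m - 1)"
        unfolding P'_def using p' by (intro abs_sum_mult_le) force
      also have "\<dots> \<le> int N * (D ^ m - 1)"
        using c Dm by (intro mult_right_mono) auto
      finally have P': "\<bar>P'\<bar> < M" by (simp add: M_def)
      have MP: "(\<Sum>i<d. c i * (M * p i + p' i)) = M * P + P'"
        unfolding P_def P'_def by (simp add: sum_distrib_left sum.distrib algebra_simps)
      have "sgn (of_int P + R) = of_int (sgn (M * P + P'))"
      proof (cases "P = 0")
        case True
        then show ?thesis using sg[OF c] by (simp add: R_def P'_def)
      next
        case False
        then have "\<bar>real_of_int P\<bar> \<ge> 1" by linarith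
        with R have 1: "sgn (of_int P + R) = sgn (real_of_int P)"
          by (intro sgn_add_dominant) linarith
        have "M * 1 \<le> M * \<bar>P\<bar>" using False M1 by (intro mult_left_mono) auto
        then have "\<bar>P'\<bar> < \<bar>M * P\<bar>" using P' M1 unfolding abs_mult by linarith
        then have "sgn (M * P + P') = sgn (M * P)" by (rule sgn_add_dominant)
        also have "\<dots> = sgn P" using M1 by (simp add: sgn_mult)
        finally show ?thesis using 1 by (simp add: sgn_if)
      qed
      then show "sgn (\<Sum>i<d. of_int (c i) * w i) = of_int (sgn (\<Sum>i<d. c i * (M * p i + p' i)))"
        unfolding MP using W by (simp add: W_def)
    qed
  qed
qed

lemma sign_preserving_rounding:
  fixes w :: "nat \<Rightarrow> real" and N d :: nat
  assumes "N > 0"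
  obtains p :: "nat \<Rightarrow> int"
  where "\<And>i. i < d \<Longrightarrow> \<bar>p i\<bar> < int (N * (2 * N) ^ d + 1) ^ d"
    and "\<And>c. (\<Sum>i<d. \<bar>c i\<bar>) \<le> int N \<Longrightarrow>
           sgn (\<Sum>i<d. of_int (c i) * w i) = of_int (sgn (\<Sum>i<d. c i * p i))"
proof -
  have "card {i. i < d \<and> w i \<noteq> 0} \<le> card {..<d}" by (intro card_mono) auto
  then show thesis
    using sign_preserving_rounding_aux[OF assms, of d w d] that by auto
qed

lemma rounding_bound_le:
  fixes N d :: nat
  assumes "N > 0"
  shows "(N * (2 * N) ^ d + 1) ^ d \<le> 2 ^ (2 * N * (d + 1) * d)"
proof -
  have "N * (2 * N) ^ d + 1 \<le> N * (2 * N) ^ d + N * (2 * N) ^ d"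
    using assms by simp
  also have "\<dots> = (2 * N) ^ (d + 1)" by simp
  also have "\<dots> \<le> (2 ^ (2 * N)) ^ (d + 1)"
    by (rule power_mono[OF less_imp_le[OF less_exp]]) simp
  finally have "N * (2 * N) ^ d + 1 \<le> 2 ^ (2 * N * (d + 1))" by (simp only: power_mult)
  then have "(N * (2 * N) ^ d + 1) ^ d \<le> (2 ^ (2 * N * (d + 1))) ^ d" by (intro power_mono) auto
  then show ?thesis by (simp only: power_mult)
qed

text \<open>The exponent of \<open>rounding_bound_le\<close> for norm \<open>N = n + 2\<close> and
  dimension \<open>d = n + 1\<close>, the indices being \<open>0, ..., n\<close>.\<close>

definition sqrt_weight_bits :: "nat \<Rightarrow> nat" where
  "sqrt_weight_bits n = 2 * (n + 2) * (n + 2) * (n + 1)"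

text \<open>The first two properties are sign conditions as well: the unit vector at
  \<open>0\<close> and the differences of neighbouring unit vectors are short integer vectors, so
  the signs of \<open>sqrt 0\<close> and of \<open>sqrt (i + 1) - sqrt i\<close> carry over to the
  weights. The norm bound \<open>n + 2\<close> has room for these vectors and for the
  instances.\<close>

lemma integer_sqrt_weights:
  fixes n :: nat
  obtains w :: "nat \<Rightarrow> nat"
  where "w 0 = 0"
    and "\<And>i. i < n \<Longrightarrow> w i \<le> w (Suc i)"
    and "\<And>i. i \<le> n \<Longrightarrow> w i < 2 ^ sqrt_weight_bits n"
    and "\<And>k a \<delta>. k \<le> n \<Longrightarrow> (\<And>i. i \<in> {1..k} \<Longrightarrow> a i \<le> n \<and> \<delta> i \<in> {-1, 1}) \<Longrightarrow>
           (\<Sum>i = 1..k. \<delta> i * int (w (a i))) > 0 \<longleftrightarrow>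
           (\<Sum>i = 1..k. real_of_int (\<delta> i) * sqrt (real (a i))) > 0"
proof -
  have N: "n + 2 > 0" by simp
  obtain p :: "nat \<Rightarrow> int"
  where bnd: "\<And>i. i < n + 1 \<Longrightarrow> \<bar>p i\<bar> < int ((n + 2) * (2 * (n + 2)) ^ (n + 1) + 1) ^ (n + 1)"
    and sg: "\<And>c. (\<Sum>i<n + 1. \<bar>c i\<bar>) \<le> int (n + 2) \<Longrightarrow>
           sgn (\<Sum>i<n + 1. of_int (c i) * sqrt (real i)) = of_int (sgn (\<Sum>i<n + 1. c i * p i))"
    by (rule sign_preserving_rounding[OF N, of "n + 1" "\<lambda>i. sqrt (real i)"]) blast
  have sg_sum: "sgn (\<Sum>i\<in>I. real_of_int (\<delta> i) * sqrt (real (a i))) = of_int (sgn (\<Sum>i\<in>I. \<delta> i * p (a i)))"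
    if I: "finite I" "card I \<le> n + 2" and a: "\<And>i. i \<in> I \<Longrightarrow> a i \<le> n \<and> \<bar>\<delta> i\<bar> \<le> 1"
    for I :: "nat set" and a \<delta>
  proof -
    have ai: "a i \<le> n" if "i \<in> I" for i using a that by blast
    define c where "c b = (\<Sum>i\<in>I. if a i = b then \<delta> i else 0)" for b
    \<comment> \<open>Collects the terms with equal radicand. The ring is arbitrary because the
      identity serves both the real values \<open>sqrt b\<close> and the integers
      \<open>p b\<close>.\<close>
    have regroup: "(\<Sum>b<n + 1. of_int (c b) * f b) = (\<Sum>i\<in>I. of_int (\<delta> i) * f (a i))"
      for f :: "nat \<Rightarrow> 'a::comm_ring_1"
    proof -
      have "(\<Sum>b<n + 1. of_int (c b) * f b) =
            (\<Sum>b<n + 1. \<Sum>i\<in>I. if a i = b then of_int (\<delta> i) * f b else 0)"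
        unfolding c_def of_int_sum sum_distrib_right by (intro sum.cong refl) simp
      also have "\<dots> = (\<Sum>i\<in>I. \<Sum>b<n + 1. if a i = b then of_int (\<delta> i) * f b else 0)"
        by (rule sum.swap)
      also have "\<dots> = (\<Sum>i\<in>I. of_int (\<delta> i) * f (a i))"
        by (intro sum.cong refl) (simp add: ai less_Suc_eq_le del: sum.lessThan_Suc)
      finally show ?thesis .
    qed
    have "(\<Sum>b<n + 1. \<bar>c b\<bar>) \<le> (\<Sum>b<n + 1. \<Sum>i\<in>I. \<bar>if a i = b then \<delta> i else 0\<bar>)"
      unfolding c_def by (intro sum_mono sum_abs)
    also have "\<dots> = (\<Sum>i\<in>I. \<Sum>b<n + 1. \<bar>if a i = b then \<delta> i else 0\<bar>)"
      by (rule sum.swap)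
    also have "\<dots> = (\<Sum>i\<in>I. \<bar>\<delta> i\<bar>)"
      by (intro sum.cong refl)
        (simp add: if_distrib[of abs] ai less_Suc_eq_le del: sum.lessThan_Suc cong: if_cong)
    also have "\<dots> \<le> (\<Sum>i\<in>I. 1)"
      using a by (intro sum_mono) auto
    finally have "(\<Sum>b<n + 1. \<bar>c b\<bar>) \<le> int (n + 2)" using I by simp
    from sg[OF this] show ?thesis
      using regroup[of "\<lambda>b. sqrt (real b)"] regroup[of p] by simp
  qed
  have p0: "p 0 = 0"
    using sg_sum[of "{0}" "\<lambda>_. 0" "\<lambda>_. 1"] by (simp add: sgn_0_0)
  have mono: "p i \<le> p (Suc i)" if "i < n" for i
  proof -
    have adm: "i + j \<le> n \<and> \<bar>if j = 0 then - 1 else 1 :: int\<bar> \<le> 1" if "j \<in> {0, 1}" for j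
      using that \<open>i < n\<close> by auto
    have "sgn (sqrt (real (Suc i)) - sqrt (real i)) = of_int (sgn (p (Suc i) - p i))"
      using sg_sum[of "{0, 1}" "\<lambda>j. i + j" "\<lambda>j. if j = 0 then - 1 else 1", OF _ _ adm] by simp
    moreover have "sgn (sqrt (real (Suc i)) - sqrt (real i)) = 1" by simp
    ultimately have "sgn (p (Suc i) - p i) = 1" by linarith
    then show ?thesis by (simp add: sgn_1_pos)
  qed
  have nonneg: "i \<le> n \<Longrightarrow> p i \<ge> 0" for i
  proof (induction i)
    case (Suc i)
    then show ?case using mono[of i] by force
  qed (simp add: p0)
  have p: "int (nat (p i)) = p i" if "i \<le> n" for i using nonneg[OF that] by simp
  show thesis
  proof (rule that[of "\<lambda>i. nat (p i)"])
    fix i assume i: "i \<le> n"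
    then have "i < n + 1" by simp
    from bnd[OF this] have "\<bar>p i\<bar> < int (((n + 2) * (2 * (n + 2)) ^ (n + 1) + 1) ^ (n + 1))"
      unfolding of_nat_power .
    also have "\<dots> \<le> int (2 ^ sqrt_weight_bits n)"
      using rounding_bound_le[OF N, of "n + 1"]
      by (simp only: of_nat_le_iff sqrt_weight_bits_def add.assoc one_add_one)
    finally show "nat (p i) < 2 ^ sqrt_weight_bits n"
      using nonneg[OF i] by (simp add: nat_less_iff)
  next
    fix k a and \<delta> :: "nat \<Rightarrow> int"
    assume k: "k \<le> n" and a: "\<And>i. i \<in> {1..k} \<Longrightarrow> a i \<le> n \<and> \<delta> i \<in> {-1, 1}"
    have "sgn (\<Sum>i = 1..k. real_of_int (\<delta> i) * sqrt (real (a i))) = of_int (sgn (\<Sum>i = 1..k. \<delta> i * p (a i)))"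
      using k a by (intro sg_sum) force+
    moreover have "(\<Sum>i = 1..k. \<delta> i * int (nat (p (a i)))) = (\<Sum>i = 1..k. \<delta> i * p (a i))"
      using a p by (intro sum.cong) auto
    ultimately show "(\<Sum>i = 1..k. \<delta> i * int (nat (p (a i)))) > 0 \<longleftrightarrow>
           (\<Sum>i = 1..k. real_of_int (\<delta> i) * sqrt (real (a i))) > 0"
      by (metis of_int_0_less_iff sgn_greater)
  qed (simp_all add: p0 mono nat_mono)
qed

section \<open>The Turing machine\<close>

text \<open>
  The five tapes carry the input, the advice, the accumulator and two copies of \<open>k\<close> in unary.  The
  first copy bounds the length of the current unary block, the second counts the blocks.  The
  accumulator holds \<open>- V mod 2\<^sup>L\<close>, least significant bit first, where \<open>V\<close> is the signed sum read so
  far and \<open>L\<close> the common length of the advice words; its top bit is set iff \<open>V > 0\<close>.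

  The first argument of the parametrised states is the sign of the current block.  The second one
  records in \<open>Unary\<close> whether the block is already nonempty, in \<open>Digit\<close> and \<open>Bit\<close> the carry or borrow.
\<close>

datatype ussr_state =
    Accept | Reject | Prefix | Block | Final
  | Rewind bool | Unary bool bool | AccRewind bool | Digit bool bool | Bit bool bool

fun encode_state :: "ussr_state \<Rightarrow> nat" where
  "encode_state Accept = 0"
| "encode_state Reject = 1"
| "encode_state Prefix = 2"
| "encode_state Block = 3"
| "encode_state Final = 4"
| "encode_state (Rewind s) = 5 + of_bool s"
| "encode_state (Unary s z) = 7 + 2 * of_bool s + of_bool z"
| "encode_state (AccRewind s) = 11 + of_bool s"
| "encode_state (Digit s c) = 13 + 2 * of_bool s + of_bool c"
| "encode_state (Bit s c) = 17 + 2 * of_bool s + of_bool c"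

lemma encode_state_less: "encode_state s < 21"
  by (cases s) auto

lemma inj_encode_state: "inj encode_state"
proof (rule injI)
  fix s t assume "encode_state s = encode_state t"
  then show "s = t" by (cases s; cases t) (auto simp: of_bool_def split: if_splits)
qed

text \<open>A positive sign \<open>s\<close> means subtraction, where the borrow is the carry with \<open>d\<close> negated.\<close>

fun add_carry :: "bool \<Rightarrow> bool \<Rightarrow> bool \<Rightarrow> bool \<Rightarrow> bool" where
  "add_carry s c d b = ((d \<noteq> s) \<and> b \<or> (d \<noteq> s) \<and> c \<or> b \<and> c)"

text \<open>Sum and difference of two bits have the same parity, so the sign affects only the
  carry.\<close>

fun add_digit :: "bool \<Rightarrow> bool \<Rightarrow> bool \<Rightarrow> bool" where
  "add_digit c d b = ((d \<noteq> b) \<noteq> c)"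

text \<open>In \<open>Unary\<close>, the test \<open>k \<noteq> 0\<close> enforces that a block is
  no longer than \<open>k\<close>, and \<open>z\<close> that it is nonempty; \<open>Block\<close>
  requires the input and the block counter to run out together. Between additions the accumulator
  head rests on the blank behind the top bit, hence the left moves on entering
  \<open>AccRewind\<close> and \<open>Final\<close>.\<close>

fun ussr_delta ::
  "ussr_state \<Rightarrow> nat \<Rightarrow> nat \<Rightarrow> nat \<Rightarrow> nat \<Rightarrow> nat \<Rightarrow> ussr_state \<times> (nat \<times> move) list" where
  "ussr_delta Prefix x y a k c =
     (if x = 2 then (Prefix, [(x, MoveRight), (y, Stay), (a, Stay), (1, MoveRight), (1, MoveRight)])
      else if x = 1 then (Block, [(x, MoveRight), (y, Stay), (a, Stay), (k, Stay), (c, MoveLeft)])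
      else (Reject, [(x, Stay), (y, Stay), (a, Stay), (k, Stay), (c, Stay)]))"
| "ussr_delta Block x y a k c =
     (if x = 0 \<and> c = 0 then (Final, [(x, Stay), (y, Stay), (a, MoveLeft), (k, Stay), (c, Stay)])
      else if x = 0 \<or> c = 0 then (Reject, [(x, Stay), (y, Stay), (a, Stay), (k, Stay), (c, Stay)])
      else (Rewind (x = 2),
            [(x, MoveRight), (y, MoveLeft), (a, Stay), (k, MoveLeft), (c, MoveLeft)]))"
| "ussr_delta (Rewind s) x y a k c =
     (if y = 0 \<and> k = 0
      then (Unary s False, [(x, Stay), (y, MoveRight), (a, Stay), (k, MoveRight), (c, Stay)])
      else (Rewind s,
            [(x, Stay), (y, if y = 0 then Stay else MoveLeft), (a, Stay),
             (k, if k = 0 then Stay else MoveLeft), (c, Stay)]))"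
| "ussr_delta (Unary s z) x y a k c =
     (if x = 2 \<and> k \<noteq> 0
      then (AccRewind s, [(x, MoveRight), (y, Stay), (a, MoveLeft), (k, MoveRight), (c, Stay)])
      else if x = 1 \<and> z
      then (Block, [(x, MoveRight), (y, Stay), (a, Stay), (k, Stay), (c, Stay)])
      else (Reject, [(x, Stay), (y, Stay), (a, Stay), (k, Stay), (c, Stay)]))"
| "ussr_delta (AccRewind s) x y a k c =
     (if a = 0
      then (Digit s False, [(x, Stay), (y, Stay), (a, MoveRight), (k, Stay), (c, Stay)])
      else (AccRewind s, [(x, Stay), (y, Stay), (a, MoveLeft), (k, Stay), (c, Stay)]))"
| "ussr_delta (Digit s r) x y a k c =
     (if y = 2 then (Bit s r, [(x, Stay), (y, MoveRight), (a, Stay), (k, Stay), (c, Stay)])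
      else (Unary s True, [(x, Stay), (y, MoveRight), (a, Stay), (k, Stay), (c, Stay)]))"
| "ussr_delta (Bit s r) x y a k c =
     (Digit s (add_carry s r (a = 2) (y = 2)),
      [(x, Stay), (y, MoveRight), (if add_digit r (a = 2) (y = 2) then 2 else 1, MoveRight),
       (k, Stay), (c, Stay)])"
| "ussr_delta Final x y a k c =
     (if a = 2 then Accept else Reject, [(x, Stay), (y, Stay), (a, Stay), (k, Stay), (c, Stay)])"
| "ussr_delta s x y a k c = (s, [(x, Stay), (y, Stay), (a, Stay), (k, Stay), (c, Stay)])"

definition ussr_tm :: tm where
  "ussr_tm =
     \<lparr>num_tapes = 5, num_states = 21, num_symbols = 3,
      start_state = encode_state Prefix,
      accept_state = encode_state Accept,
      reject_state = encode_state Reject,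
      trans = (\<lambda>q ss.
        apfst encode_state
          (ussr_delta (inv encode_state q) (ss ! 0) (ss ! 1) (ss ! 2) (ss ! 3) (ss ! 4)))\<rparr>"

lemma ussr_delta_acts:
  assumes "ussr_delta s x y a k c = (s', acts)"
    and "x < 3" "y < 3" "a < 3" "k < 3" "c < 3"
  shows "length acts = 5 \<and> (\<forall>(u, m)\<in>set acts. u < 3)"
  using assms by (cases s) (auto split: if_splits)

lemma wf_ussr_tm: "wf_tm ussr_tm"
proof -
  have "q' < 21 \<and> length acts = 5 \<and> (\<forall>(s, m)\<in>set acts. s < 3)"
    if "length ss = 5" and ss: "\<forall>s\<in>set ss. s < 3" and "trans ussr_tm q ss = (q', acts)"
    for q ss q' acts
  proof -
    from that obtain s' where "q' = encode_state s'" and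
      d: "ussr_delta (inv encode_state q) (ss ! 0) (ss ! 1) (ss ! 2) (ss ! 3) (ss ! 4) = (s', acts)"
      by (auto simp: ussr_tm_def apfst_def map_prod_def split: prod.splits)
    moreover have "ss ! i < 3" if "i < 5" for i using ss that \<open>length ss = 5\<close> by auto
    ultimately show ?thesis using ussr_delta_acts[OF d] encode_state_less by auto
  qed
  then show ?thesis
    unfolding wf_tm_def by (simp add: ussr_tm_def) blast
qed

section \<open>Tapes holding bit words\<close>

declare encode_state.simps [simp del] tm_step.simps [simp del]
declare add_carry.simps [simp del] add_digit.simps [simp del]

definition bit_symbol :: "bool list \<Rightarrow> int \<Rightarrow> nat" where
  "bit_symbol xs i = (if 0 \<le> i \<and> i < int (length xs) then (if xs ! nat i then 2 else 1) else 0)"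

lemma bits_tape_eq: "bits_tape xs = (bit_symbol xs, 0)"
  by (auto simp: bits_tape_def bit_symbol_def)

lemma blank_tape_eq: "blank_tape = (bit_symbol [], 0)"
  by (auto simp: blank_tape_def bit_symbol_def)

lemma bit_symbol_append_length [simp]:
  "bit_symbol (xs @ ys) (int (length xs)) = (case ys of [] \<Rightarrow> 0 | y # _ \<Rightarrow> if y then 2 else 1)"
  by (auto simp: bit_symbol_def nth_append split: list.splits)

lemma bit_symbol_length [simp]: "bit_symbol xs (int (length xs)) = 0"
  by (simp add: bit_symbol_def)

lemma bit_symbol_eq_0_iff: "bit_symbol xs i = 0 \<longleftrightarrow> i < 0 \<or> int (length xs) \<le> i"
  by (auto simp: bit_symbol_def)

text \<open>Since \<open>tl [] = []\<close>, one equation covers overwriting a digit and extending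
  the word by a cell; the latter happens in the first addition and when the counters are
  built.\<close>

lemma bit_symbol_write:
  "(bit_symbol (xs @ ys))(int (length xs) := if b then 2 else 1) = bit_symbol (xs @ b # tl ys)"
proof
  fix i
  show "((bit_symbol (xs @ ys))(int (length xs) := if b then 2 else 1)) i =
        bit_symbol (xs @ b # tl ys) i"
  proof (cases "0 \<le> i")
    case True
    then obtain j where "i = int j" by (metis nonneg_int_cases)
    then show ?thesis
      by (cases ys) (auto simp: bit_symbol_def nth_append nth_Cons' Suc_diff_le)
  qed (auto simp: bit_symbol_def)
qed

text \<open>The counters are words of \<open>False\<close> because the machine fills them with the
  symbol \<open>1\<close>, which stands for that bit. They have equal content and differ only in the
  head position.\<close>

abbreviation config ::
  "ussr_state \<Rightarrow> bool list \<Rightarrow> int \<Rightarrow> bool list \<Rightarrow> int \<Rightarrow> bool list \<Rightarrow> int \<Rightarrow>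
   nat \<Rightarrow> int \<Rightarrow> int \<Rightarrow> tm_config" where
  "config s x hx y hy a ha k hk hc \<equiv>
     (encode_state s, [(bit_symbol x, hx), (bit_symbol y, hy), (bit_symbol a, ha),
        (bit_symbol (replicate k False), hk), (bit_symbol (replicate k False), hc)])"

lemma tm_step_ussr:
  assumes "s \<noteq> Accept" "s \<noteq> Reject"
  shows "tm_step ussr_tm (encode_state s, [(f0, h0), (f1, h1), (f2, h2), (f3, h3), (f4, h4)]) =
    (case ussr_delta s (f0 h0) (f1 h1) (f2 h2) (f3 h3) (f4 h4) of (s', acts) \<Rightarrow>
       (encode_state s', map2 act_tape acts [(f0, h0), (f1, h1), (f2, h2), (f3, h3), (f4, h4)]))"
proof -
  have "encode_state s \<noteq> encode_state Accept" "encode_state s \<noteq> encode_state Reject"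
    using assms inj_encode_state by (metis injD)+
  then show ?thesis
    by (simp add: tm_step.simps ussr_tm_def inv_f_f[OF inj_encode_state] numeral_eq_Suc split: prod.splits)
qed

section \<open>Runs within a time bound\<close>

definition reaches :: "nat \<Rightarrow> tm_config \<Rightarrow> tm_config \<Rightarrow> bool" where
  "reaches T c c' \<longleftrightarrow> (\<exists>t\<le>T. (tm_step ussr_tm ^^ t) c = c')"

definition decides :: "nat \<Rightarrow> tm_config \<Rightarrow> bool \<Rightarrow> bool" where
  "decides T c b \<longleftrightarrow>
     (\<exists>t\<le>T. fst ((tm_step ussr_tm ^^ t) c) = encode_state (if b then Accept else Reject))"

lemma reaches_refl: "reaches T c c"
  unfolding reaches_def by (intro exI[of _ 0]) simp

lemma reaches_Suc: "tm_step ussr_tm c = c1 \<Longrightarrow> reaches T c1 c' \<Longrightarrow> reaches (Suc T) c c'"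
  unfolding reaches_def by (metis Suc_le_mono comp_apply funpow_Suc_right)

lemma decides_Suc: "tm_step ussr_tm c = c1 \<Longrightarrow> decides T c1 b \<Longrightarrow> decides (Suc T) c b"
  unfolding decides_def by (metis Suc_le_mono comp_apply funpow_Suc_right)

lemma decides_0: "fst c = encode_state (if b then Accept else Reject) \<Longrightarrow> decides T c b"
  unfolding decides_def by (intro exI[of _ 0]) simp

lemma decides_mono: "decides T c b \<Longrightarrow> T \<le> T' \<Longrightarrow> decides T' c b"
  unfolding decides_def using order.trans by blast

lemma reaches_decides:
  assumes "reaches T c c'" "decides T' c' b"
  shows "decides (T + T') c b"
proof -
  obtain t t' where "t \<le> T" "(tm_step ussr_tm ^^ t) c = c'"
    "t' \<le> T'" "fst ((tm_step ussr_tm ^^ t') c') = encode_state (if b then Accept else Reject)"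
    using assms unfolding reaches_def decides_def by blast
  then show ?thesis
    unfolding decides_def
    by (intro exI[of _ "t' + t"]) (simp add: funpow_add)
qed

section \<open>Rewinding and digitwise addition\<close>

lemma reaches_Rewind:
  assumes "i \<le> m" "j \<le> m" "i \<le> length y" "j \<le> k"
  shows "reaches (Suc m) (config (Rewind s) x hx y (int i - 1) a ha k (int j - 1) hc)
           (config (Unary s False) x hx y 0 a ha k 0 hc)"
  using assms
proof (induction m arbitrary: i j)
  case 0
  then show ?case
    by (intro reaches_Suc[OF _ reaches_refl])
      (simp add: tm_step_ussr bit_symbol_eq_0_iff)
next
  case (Suc m)
  show ?case
  proof (cases "i = 0 \<and> j = 0")
    case True
    then show ?thesis
      by (intro reaches_Suc[OF _ reaches_refl])
        (simp add: tm_step_ussr bit_symbol_eq_0_iff)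
  next
    case False
    show ?thesis
    \<comment> \<open>Truncated subtraction mirrors the machine: a head that has reached the blank
      at \<open>-1\<close> waits there for the other one.\<close>
    proof (rule reaches_Suc[OF _ Suc.IH[of "i - 1" "j - 1"]])
      show "tm_step ussr_tm (config (Rewind s) x hx y (int i - 1) a ha k (int j - 1) hc) =
        config (Rewind s) x hx y (int (i - 1) - 1) a ha k (int (j - 1) - 1) hc"
        using False Suc.prems
        by (cases i; cases j)
          (auto simp: tm_step_ussr bit_symbol_eq_0_iff)
    qed (use Suc.prems in auto)
  qed
qed

lemma reaches_AccRewind:
  assumes "i \<le> length a"
  shows "reaches (Suc i) (config (AccRewind s) x hx y hy a (int i - 1) k hk hc)
           (config (Digit s False) x hx y hy a 0 k hk hc)"
  using assms
proof (induction i)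
  case 0
  then show ?case
    by (intro reaches_Suc[OF _ reaches_refl])
      (simp add: tm_step_ussr bit_symbol_eq_0_iff)
next
  case (Suc i)
  show ?case
    using Suc
    by (intro reaches_Suc[OF _ Suc.IH])
      (simp_all add: tm_step_ussr bit_symbol_eq_0_iff)
qed

text \<open>The accumulator is blank before the first addition, so \<open>ds\<close> may be empty and then counts as \<open>0\<close>.\<close>

fun add_bits :: "bool \<Rightarrow> bool \<Rightarrow> bool list \<Rightarrow> bool list \<Rightarrow> bool list" where
  "add_bits s c ds [] = []"
| "add_bits s c ds (b # bs) =
     (let d = (ds \<noteq> [] \<and> hd ds)
      in add_digit c d b # add_bits s (add_carry s c d b) (tl ds) bs)"

lemma length_add_bits [simp]: "length (add_bits s c ds bs) = length bs"
  by (induction s c ds bs rule: add_bits.induct) (auto simp: Let_def)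

abbreviation bits_val :: "bool list \<Rightarrow> int" where
  "bits_val \<equiv> horner_sum of_bool 2"

text \<open>The carry or borrow out of the top digit is dropped, and \<open>q\<close> accounts for
  it; the result is thus correct modulo \<open>2 ^ length bs\<close>. The incoming carry has the
  sign of the operand because it is a borrow in a subtraction.\<close>

lemma bits_val_add_bits:
  assumes "length ds = length bs \<or> ds = []"
  shows "\<exists>q. bits_val (add_bits s c ds bs) =
    bits_val ds + (if s then - 1 else 1) * (bits_val bs + of_bool c) + 2 ^ length bs * q"
  using assms
proof (induction s c ds bs rule: add_bits.induct)
  case (1 s c ds)
  then show ?case by (intro exI[of _ "- (if s then - 1 else 1) * of_bool c"]) auto
next
  case (2 s c ds b bs)
  define d where "d = (ds \<noteq> [] \<and> hd ds)"
  have "length (tl ds) = length bs \<or> tl ds = []" using 2 by auto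
  from "2.IH"[OF d_def this] obtain q where
    q: "bits_val (add_bits s (add_carry s c d b) (tl ds) bs) =
        bits_val (tl ds) + (if s then - 1 else 1) * (bits_val bs + of_bool (add_carry s c d b))
        + 2 ^ length bs * q" by blast
  have ds: "bits_val ds = of_bool d + 2 * bits_val (tl ds)"
    by (cases ds) (auto simp: d_def)
  \<comment> \<open>Full adder and full subtractor in one identity, verified over all bit
    values.\<close>
  have dig: "of_bool (add_digit c d b) + 2 * ((if s then - 1 else 1) * of_bool (add_carry s c d b)) =
      of_bool d + (if s then - 1 else 1) * (of_bool b + of_bool c :: int)"
    by (auto simp: add_digit.simps add_carry.simps)
  have "bits_val (add_bits s c ds (b # bs)) =
      of_bool (add_digit c d b) + 2 * bits_val (add_bits s (add_carry s c d b) (tl ds) bs)"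
    by (simp add: Let_def d_def)
  also have "\<dots> = (of_bool (add_digit c d b)
        + 2 * ((if s then - 1 else 1) * of_bool (add_carry s c d b)))
      + 2 * bits_val (tl ds) + (if s then - 1 else 1) * (2 * bits_val bs) + 2 ^ Suc (length bs) * q"
    unfolding q by (simp only: distrib_left power_Suc ac_simps)
  also have "\<dots> = bits_val ds + (if s then - 1 else 1) * (bits_val (b # bs) + of_bool c)
      + 2 ^ length (b # bs) * q"
    unfolding dig ds by (simp only: horner_sum_simps list.size distrib_left power_Suc ac_simps) simp
  finally show ?case by blast
qed

text \<open>Advice is a plain bit string without separators, so the words delimit themselves:
  \<open>True\<close> announces a digit, \<open>False\<close> ends the word. The machine hence works
  without knowing the word length.\<close>

definition advice_block :: "bool list \<Rightarrow> bool list" where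
  "advice_block bs = concat (map (\<lambda>b. [True, b]) bs) @ [False]"

lemma length_advice_block [simp]: "length (advice_block bs) = 2 * length bs + 1"
  unfolding advice_block_def by (induction bs) auto

text \<open>The processed parts \<open>pre\<close> and \<open>ds\<close> are arbitrary, so that the
  induction can follow the unread digits of the word. The case \<open>es = []\<close> is the first
  addition, which creates the accumulator.\<close>

lemma reaches_Digit:
  assumes "length es = length bs \<or> es = []"
  shows "reaches (2 * length bs + 1)
    (config (Digit s r) x hx (pre @ advice_block bs @ post) (int (length pre))
       (ds @ es) (int (length ds)) k hk hc)
    (config (Unary s True) x hx (pre @ advice_block bs @ post) (int (length (pre @ advice_block bs)))
       (ds @ add_bits s r es bs) (int (length (ds @ add_bits s r es bs))) k hk hc)"
  using assms
proof (induction bs arbitrary: pre ds es r)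
  case Nil
  have "tm_step ussr_tm (config (Digit s r) x hx (pre @ advice_block [] @ post) (int (length pre))
        (ds @ es) (int (length ds)) k hk hc) =
      config (Unary s True) x hx (pre @ advice_block [] @ post) (int (length (pre @ advice_block [])))
        (ds @ add_bits s r es []) (int (length (ds @ add_bits s r es []))) k hk hc"
    using Nil by (simp add: tm_step_ussr advice_block_def fun_upd_idem)
  from reaches_Suc[OF this reaches_refl[of 0]] show ?case by simp
next
  case (Cons b bs)
  define d where "d = (es \<noteq> [] \<and> hd es)"
  have blk: "advice_block (b # bs) = [True, b] @ advice_block bs" by (simp add: advice_block_def)
  have es: "length (tl es) = length bs \<or> tl es = []" using Cons.prems by auto
  have sym: "bit_symbol (pre @ True # b # advice_block bs @ post) (int (length pre) + 1) =
      (if b then 2 else 1)"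
    using bit_symbol_append_length[of "pre @ [True]" "b # advice_block bs @ post"]
    by (simp add: add.commute)
  have d: "(case es of [] \<Rightarrow> 0 | y # _ \<Rightarrow> if y then 2 else (1::nat)) = 2 \<longleftrightarrow> d"
    by (auto simp: d_def split: list.splits)
  have 1: "tm_step ussr_tm (config (Digit s r) x hx (pre @ advice_block (b # bs) @ post)
        (int (length pre)) (ds @ es) (int (length ds)) k hk hc) =
      config (Bit s r) x hx (pre @ advice_block (b # bs) @ post)
        (int (length pre) + 1) (ds @ es) (int (length ds)) k hk hc"
    by (simp add: tm_step_ussr fun_upd_idem blk)
  have 2: "tm_step ussr_tm (config (Bit s r) x hx (pre @ advice_block (b # bs) @ post)
        (int (length pre) + 1) (ds @ es) (int (length ds)) k hk hc) =
      config (Digit s (add_carry s r d b)) x hx ((pre @ [True, b]) @ advice_block bs @ post)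
        (int (length (pre @ [True, b]))) ((ds @ [add_digit r d b]) @ tl es)
        (int (length (ds @ [add_digit r d b]))) k hk hc"
    by (simp add: tm_step_ussr fun_upd_idem blk sym d bit_symbol_write)
  show ?case
    using reaches_Suc[OF 1 reaches_Suc[OF 2 Cons.IH[OF es]]]
    by (simp add: blk d_def[symmetric] Let_def)
qed

lemma last_bits_iff:
  assumes "bs \<noteq> []"
  shows "last bs \<longleftrightarrow> 2 ^ (length bs - 1) \<le> bits_val bs"
proof -
  have bs: "bs = butlast bs @ [last bs]" using assms by simp
  have lt: "bits_val (butlast bs) < 2 ^ (length bs - 1)"
    using horner_sum_of_bool_2_less[of "butlast bs"] by simp
  have "bits_val bs = bits_val (butlast bs) + 2 ^ (length bs - 1) * of_bool (last bs)"
    by (subst bs, subst horner_sum_append) simp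
  moreover have "bits_val (butlast bs) \<ge> 0" by (simp add: horner_sum_nonnegative)
  ultimately show ?thesis using lt by (cases "last bs") auto
qed

section \<open>Correctness of the machine\<close>

text \<open>
  The machine between two additions: \<open>None\<close> is the start of a block, \<open>Some (s, j)\<close> the position after
  \<open>j\<close> ones of a block with sign \<open>s\<close>; \<open>c\<close> blocks are still to come.  The test \<open>F\<close> is a parameter
  because the machine knows \<open>V\<close> only modulo \<open>2\<^sup>L\<close>.
\<close>

fun ussr_run :: "(nat \<Rightarrow> int) \<Rightarrow> nat \<Rightarrow> (int \<Rightarrow> bool) \<Rightarrow>
    (bool \<times> nat) option \<Rightarrow> nat \<Rightarrow> int \<Rightarrow> bool list \<Rightarrow> bool" where
  "ussr_run u k F None c V [] \<longleftrightarrow> c = 0 \<and> F V"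
| "ussr_run u k F None c V (s # xs) \<longleftrightarrow> 0 < c \<and> ussr_run u k F (Some (s, 0)) (c - 1) V xs"
| "ussr_run u k F (Some (s, j)) c V [] \<longleftrightarrow> False"
| "ussr_run u k F (Some (s, j)) c V (True # xs) \<longleftrightarrow>
     j < k \<and> ussr_run u k F (Some (s, Suc j)) c (V + (if s then 1 else - 1) * u j) xs"
| "ussr_run u k F (Some (s, j)) c V (False # xs) \<longleftrightarrow> 0 < j \<and> ussr_run u k F None c V xs"

text \<open>Both claims go through one induction over the unread input. The counter head stands at
  \<open>c - 1\<close>, which is blank exactly when \<open>c = 0\<close>; inside a block the advice
  head stands at the start of word \<open>j\<close>. \<open>B\<close> pays for one input symbol:
  starting a block takes at most \<open>length y + k + 2\<close> steps, an addition at most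
  \<open>3 * L + 3\<close>. The extra \<open>2\<close> covers the final test.\<close>

lemma decides_ussr_run:
  fixes us :: "bool list list" and L k B :: nat
  defines "y \<equiv> concat (map advice_block us)"
    and "u \<equiv> \<lambda>j. bits_val (us ! j)"
    and "F \<equiv> \<lambda>V. 2 ^ (L - 1) \<le> (- V) mod 2 ^ L"
  assumes us: "\<forall>bs\<in>set us. length bs = L" and L: "L > 0" and k: "k \<le> length us"
    and B: "B \<ge> length y + k + 3 * L + 5"
  shows "i \<le> length y \<Longrightarrow> j \<le> k \<Longrightarrow> c \<le> k \<Longrightarrow> as = [] \<or> length as = L \<Longrightarrow>
      bits_val as = (- V) mod 2 ^ L \<Longrightarrow>
      decides (B * length rest + 2)
        (config Block (pre @ rest) (int (length pre)) y (int i) as (int (length as)) k (int j) (int c - 1))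
        (ussr_run u k F None c V rest)"
    and "j \<le> k \<Longrightarrow> c \<le> k \<Longrightarrow> as = [] \<or> length as = L \<Longrightarrow>
      bits_val as = (- V) mod 2 ^ L \<Longrightarrow>
      decides (B * length rest + 2)
        (config (Unary s (0 < j)) (pre @ rest) (int (length pre)) y
           (int (length (concat (map advice_block (take j us))))) as (int (length as)) k (int j) (int c - 1))
        (ussr_run u k F (Some (s, j)) c V rest)"
proof (induction rest arbitrary: pre i j c as V s)
  case Nil
  {
    case (1 pre i j c as V)
    show ?case
    proof (cases "c = 0")
      case True
      \<comment> \<open>A blank accumulator represents \<open>0\<close>, for which \<open>F\<close>
        fails, and the blank read in its place is likewise not \<open>2\<close>.\<close>
      have top: "bit_symbol as (int (length as) - 1) = 2 \<longleftrightarrow> F V"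
      proof (cases as rule: rev_cases)
        case Nil
        with 1 show ?thesis by (simp add: F_def bit_symbol_def flip: 1(5))
      next
        case (snoc bs b)
        have "bit_symbol as (int (length as) - 1) = 2 \<longleftrightarrow> last as" using snoc by simp
        also have "\<dots> \<longleftrightarrow> 2 ^ (length as - 1) \<le> bits_val as" using snoc by (intro last_bits_iff) simp
        also have "\<dots> \<longleftrightarrow> F V" using snoc 1(4,5) by (auto simp: F_def)
        finally show ?thesis .
      qed
      have "decides (Suc (Suc 0)) (config Block (pre @ []) (int (length pre)) y (int i)
          as (int (length as)) k (int j) (int c - 1)) (F V)"
      proof (rule decides_Suc[OF _ decides_Suc[OF refl decides_0]])
        show "tm_step ussr_tm (config Block (pre @ []) (int (length pre)) y (int i)
            as (int (length as)) k (int j) (int c - 1)) =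
          config Final (pre @ []) (int (length pre)) y (int i)
            as (int (length as) - 1) k (int j) (int c - 1)"
          using True by (simp add: tm_step_ussr fun_upd_idem bit_symbol_eq_0_iff)
      qed (simp add: tm_step_ussr top)
      then show ?thesis using True by (simp add: numeral_2_eq_2)
    next
      case False
      have "decides (Suc 0) (config Block (pre @ []) (int (length pre)) y (int i)
          as (int (length as)) k (int j) (int c - 1)) False"
        using False 1(3)
        by (intro decides_Suc[OF refl decides_0]) (simp add: tm_step_ussr bit_symbol_eq_0_iff)
      then show ?thesis using False by (auto intro: decides_mono)
    qed
  next
    case (2 pre j c as V s)
    have "decides (Suc 0) (config (Unary s (0 < j)) (pre @ []) (int (length pre)) y
           (int (length (concat (map advice_block (take j us))))) as (int (length as)) k (int j)
           (int c - 1)) False"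
      by (intro decides_Suc[OF refl decides_0]) (simp add: tm_step_ussr bit_symbol_eq_0_iff)
    then show ?case by (auto intro: decides_mono)
  }
next
  case (Cons b rest)
  have pre: "pre @ b # rest = (pre @ [b]) @ rest" by simp
  {
    case (1 pre i j c as V)
    show ?case
    proof (cases "c = 0")
      case True
      have "decides (Suc 0) (config Block (pre @ b # rest) (int (length pre)) y (int i)
          as (int (length as)) k (int j) (int c - 1)) False"
        using True
        by (intro decides_Suc[OF refl decides_0]) (simp add: tm_step_ussr bit_symbol_eq_0_iff)
      then show ?thesis using True by (auto intro: decides_mono)
    next
      case False
      let ?conf = "\<lambda>s hy hk. config s (pre @ b # rest) (int (length (pre @ [b]))) y hy
          as (int (length as)) k hk (int (c - 1) - 1)"
      have 1: "tm_step ussr_tm (config Block (pre @ b # rest) (int (length pre)) y (int i)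
          as (int (length as)) k (int j) (int c - 1)) = ?conf (Rewind b) (int i - 1) (int j - 1)"
        using False 1(3)
        by (auto simp: tm_step_ussr fun_upd_idem bit_symbol_eq_0_iff of_nat_diff)
      have 2: "reaches (Suc (length y + k)) (?conf (Rewind b) (int i - 1) (int j - 1))
          (?conf (Unary b False) 0 0)"
        using "1.prems" by (intro reaches_Rewind) auto
      have 3: "decides (B * length rest + 2) (?conf (Unary b False) 0 0)
          (ussr_run u k F (Some (b, 0)) (c - 1) V rest)"
        using Cons.IH(2)[of 0 "c - 1" as V b "pre @ [b]"] "1.prems" by simp
      have "decides (Suc (Suc (length y + k) + (B * length rest + 2)))
          (config Block (pre @ b # rest) (int (length pre)) y (int i)
            as (int (length as)) k (int j) (int c - 1))
          (ussr_run u k F (Some (b, 0)) (c - 1) V rest)"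
        by (rule decides_Suc[OF 1 reaches_decides[OF 2 3]])
      then show ?thesis
        using False B by (auto elim!: decides_mono)
    qed
  next
    case (2 pre j c as V s)
    let ?y = "\<lambda>j. concat (map advice_block (take j us))"
    let ?conf = "\<lambda>s hy as ha hk. config s (pre @ b # rest) (int (length (pre @ [b]))) y hy
          as ha k hk (int c - 1)"
    let ?start = "config (Unary s (0 < j)) (pre @ b # rest) (int (length pre)) y
           (int (length (?y j))) as (int (length as)) k (int j) (int c - 1)"
    have reject: ?case
      if "tm_step ussr_tm ?start = (encode_state Reject, snd ?start)"
        "\<not> ussr_run u k F (Some (s, j)) c V (b # rest)"
    proof -
      have "decides (Suc 0) ?start False"
        using that(1) by (intro decides_Suc[OF that(1) decides_0]) simp
      then show ?thesis using that(2) by (auto intro: decides_mono)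
    qed
    show ?case
    proof (cases b)
      case True
      show ?thesis
      proof (cases "j < k")
        case False
        show ?thesis
          using False True 2
          by (intro reject) (auto simp: tm_step_ussr fun_upd_idem bit_symbol_eq_0_iff)
      next
        case jk: True
        define bs where "bs = us ! j"
        define as' where "as' = add_bits s False as bs"
        have bs: "length bs = L" using us jk k by (simp add: bs_def)
        have yj: "y = ?y j @ advice_block bs @ concat (map advice_block (drop (Suc j) us))"
          unfolding y_def bs_def using jk k
          by (subst id_take_nth_drop[of j us]) simp_all
        have ySuc: "?y (Suc j) = ?y j @ advice_block bs"
          using jk k by (simp add: take_Suc_conv_app_nth bs_def)
        have as: "length as \<le> L" "length as = length bs \<or> as = []" using 2(3) bs by auto
        have 1: "tm_step ussr_tm ?start =
            ?conf (AccRewind s) (int (length (?y j))) as (int (length as) - 1) (int (Suc j))"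
          using jk True
          by (auto simp: tm_step_ussr fun_upd_idem bit_symbol_eq_0_iff)
        have r2: "reaches (Suc (length as))
            (?conf (AccRewind s) (int (length (?y j))) as (int (length as) - 1) (int (Suc j)))
            (?conf (Digit s False) (int (length (?y j))) as 0 (int (Suc j)))"
          by (rule reaches_AccRewind) simp
        have r3: "reaches (2 * length bs + 1)
            (?conf (Digit s False) (int (length (?y j))) as 0 (int (Suc j)))
            (?conf (Unary s True) (int (length (?y (Suc j)))) as' (int (length as')) (int (Suc j)))"
          using reaches_Digit[OF as(2), of s False "pre @ b # rest" "int (length (pre @ [b]))"
              "?y j" "concat (map advice_block (drop (Suc j) us))" "[]" k "int (Suc j)" "int c - 1",
              folded yj ySuc]
          by (simp add: as'_def)
        obtain q where "bits_val as' =
            bits_val as + (if s then - 1 else 1) * (bits_val bs + of_bool False) + 2 ^ L * q"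
          using bits_val_add_bits[OF as(2), of s False] bs unfolding as'_def by blast
        then have "bits_val as' mod 2 ^ L =
            ((- V) mod 2 ^ L + (if s then - 1 else 1) * bits_val bs) mod 2 ^ L"
          using 2(4) by simp
        also have "\<dots> = (- (V + (if s then 1 else - 1) * bits_val bs)) mod 2 ^ L"
          unfolding mod_add_left_eq by (cases s) (simp_all add: algebra_simps)
        finally have "bits_val as' mod 2 ^ L = \<dots>" .
        \<comment> \<open>A word of \<open>L\<close> digits is its own residue, so the congruence
          becomes the equality demanded by the invariant.\<close>
        moreover have "bits_val as' mod 2 ^ L = bits_val as'"
          using horner_sum_of_bool_2_less[of as'] bs
          by (intro mod_pos_pos_trivial) (simp_all add: horner_sum_nonnegative as'_def)
        ultimately have val: "bits_val as' = (- (V + (if s then 1 else - 1) * u j)) mod 2 ^ L"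
          by (simp add: u_def bs_def)
        have 4: "decides (B * length rest + 2)
            (?conf (Unary s True) (int (length (?y (Suc j)))) as' (int (length as')) (int (Suc j)))
            (ussr_run u k F (Some (s, Suc j)) c (V + (if s then 1 else - 1) * u j) rest)"
          using Cons.IH(2)[of "Suc j" c as' _ s "pre @ [b]", OF _ 2(2) _ val] jk bs
          by (simp add: as'_def)
        have "decides (Suc (Suc (length as) + (2 * length bs + 1 + (B * length rest + 2)))) ?start
            (ussr_run u k F (Some (s, j)) c V (b # rest))"
          using decides_Suc[OF 1 reaches_decides[OF r2 reaches_decides[OF r3 4]]] True jk by simp
        then show ?thesis
          using B as(1) bs by (auto elim!: decides_mono)
      qed
    next
      case False
      show ?thesis
      proof (cases "j = 0")
        case True
        show ?thesis
          using True False
          by (intro reject) (auto simp: tm_step_ussr fun_upd_idem bit_symbol_eq_0_iff)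
      next
        case j0: False
        have "y = ?y j @ concat (map advice_block (drop j us))"
          unfolding y_def by (simp flip: concat_append map_append)
        then have "length (?y j) \<le> length y"
          by (metis le_add1 length_append)
        then have 1: "decides (B * length rest + 2)
            (?conf Block (int (length (?y j))) as (int (length as)) (int j))
            (ussr_run u k F None c V rest)"
          using Cons.IH(1)[of "length (?y j)" j c as V "pre @ [b]"] 2 by simp
        have "tm_step ussr_tm ?start = ?conf Block (int (length (?y j))) as (int (length as)) (int j)"
          using j0 False by (auto simp: tm_step_ussr fun_upd_idem)
        from decides_Suc[OF this 1] show ?thesis
          using j0 False B by (auto elim!: decides_mono)
      qed
    qed
  }
qed

lemma reaches_Prefix:
  "reaches k (config Prefix (replicate i True @ replicate k True @ rest) (int i) y 0 [] 0 i (int i) (int i))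
     (config Prefix (replicate i True @ replicate k True @ rest) (int (i + k)) y 0 [] 0 (i + k)
        (int (i + k)) (int (i + k)))"
proof (induction k arbitrary: i)
  case 0
  show ?case by (simp add: reaches_refl)
next
  case (Suc k)
  have w: "(bit_symbol (replicate i False))(int i := Suc 0) = bit_symbol (replicate (Suc i) False)"
    using bit_symbol_write[of "replicate i False" "[]" False]
    by (simp add: replicate_append_same)
  have x: "bit_symbol (True # replicate i True @ replicate k True @ rest) (int i) = 2"
    using bit_symbol_append_length[of "replicate i True" "True # replicate k True @ rest"]
    by (simp add: replicate_app_Cons_same)
  have "tm_step ussr_tm (config Prefix (replicate i True @ replicate (Suc k) True @ rest) (int i) y 0
        [] 0 i (int i) (int i)) =
      config Prefix (replicate (Suc i) True @ replicate k True @ rest) (int (Suc i)) y 0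
        [] 0 (Suc i) (int (Suc i)) (int (Suc i))"
    by (simp add: tm_step_ussr fun_upd_idem x w replicate_app_Cons_same)
  from reaches_Suc[OF this Suc.IH] show ?case by (simp add: replicate_app_Cons_same)
qed

lemma tm_init_ussr: "tm_init ussr_tm x y = config Prefix x 0 y 0 [] 0 0 0 0"
  by (simp add: tm_init_def ussr_tm_def bits_tape_eq blank_tape_eq numeral_eq_Suc)

text \<open>The candidate for \<open>k\<close> is the number of leading ones, determined by
  \<open>x\<close> alone. It is at most \<open>length x\<close>, so one advice word per input
  position suffices for every block.\<close>

lemma decides_tm_init:
  fixes us :: "bool list list" and L :: nat and x :: "bool list"
  defines "y \<equiv> concat (map advice_block us)"
    and "u \<equiv> \<lambda>j. bits_val (us ! j)"
    and "F \<equiv> \<lambda>V. 2 ^ (L - 1) \<le> (- V) mod 2 ^ L"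
  assumes us: "\<forall>bs\<in>set us. length bs = L" and L: "L > 0" and len: "length x \<le> length us"
  shows "decides ((length y + length x + 3 * L + 5) * length x + length x + 3)
    (tm_init ussr_tm x y)
    (\<exists>k rest. x = replicate k True @ False # rest \<and> ussr_run u k F None k 0 rest)"
proof -
  define k where "k = length (takeWhile id x)"
  define r where "r = dropWhile id x"
  have tw: "takeWhile id x = replicate k True"
    unfolding k_def by (intro replicate_length_same[symmetric]) (auto dest: set_takeWhileD)
  have x: "x = replicate k True @ r"
    unfolding r_def using takeWhile_dropWhile_id[of id x] tw by simp
  have init: "reaches k (tm_init ussr_tm x y) (config Prefix x (int k) y 0 [] 0 k (int k) (int k))"
    using reaches_Prefix[of k 0 r y] by (simp add: tm_init_ussr x)
  have sym: "bit_symbol x (int k) = (case r of [] \<Rightarrow> 0 | y # _ \<Rightarrow> if y then 2 else 1)"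
    using bit_symbol_append_length[of "replicate k True" r] by (simp add: x)
  show ?thesis
  proof (cases r)
    case Nil
    have "decides (Suc 0) (config Prefix x (int k) y 0 [] 0 k (int k) (int k)) False"
      using sym Nil by (intro decides_Suc[OF refl decides_0]) (simp add: tm_step_ussr)
    from reaches_decides[OF init this] have "decides (k + Suc 0) (tm_init ussr_tm x y) False" .
    moreover have "\<nexists>k rest. x = replicate k True @ False # rest"
      using x Nil by (metis append_Nil2 in_set_conv_decomp in_set_replicate)
    ultimately show ?thesis using x by (auto elim!: decides_mono)
  next
    case (Cons b rest)
    then have b: "b = False" using hd_dropWhile[of id x] unfolding r_def by auto
    have 1: "tm_step ussr_tm (config Prefix x (int k) y 0 [] 0 k (int k) (int k)) =
        config Block x (int k + 1) y 0 [] 0 k (int k) (int k - 1)"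
      using sym Cons b by (simp add: tm_step_ussr fun_upd_idem)
    have kx: "k \<le> length x" by (simp add: x)
    have B: "length (concat (map advice_block us)) + k + 3 * L + 5 \<le> length y + length x + 3 * L + 5"
      using kx by (simp add: y_def)
    have 2: "decides ((length y + length x + 3 * L + 5) * length rest + 2)
        (config Block x (int k + 1) y 0 [] 0 k (int k) (int k - 1))
        (ussr_run u k F None k 0 rest)"
      using decides_ussr_run(1)[OF us L _ B, of 0 k k "[]" 0 rest "replicate k True @ [False]"] kx len
      by (simp add: x Cons b y_def[symmetric] u_def F_def add.commute)
    have "(\<exists>k rest. x = replicate k True @ False # rest \<and> ussr_run u k F None k 0 rest) \<longleftrightarrow>
        ussr_run u k F None k 0 rest"
      by (auto simp: x Cons b unary_block_inject)
    moreover have "length rest \<le> length x" by (simp add: x Cons)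
    then have "(length y + length x + 3 * L + 5) * length rest \<le> (length y + length x + 3 * L + 5) * length x"
      by (rule mult_le_mono2)
    with kx have "k + Suc ((length y + length x + 3 * L + 5) * length rest + 2)
        \<le> (length y + length x + 3 * L + 5) * length x + length x + 3"
      by linarith
    ultimately show ?thesis
      using decides_mono[OF reaches_decides[OF init decides_Suc[OF 1 2]]] by simp
  qed
qed

section \<open>Runs and instances\<close>

text \<open>The increments telescope: reading \<open>m\<close> further ones adds
  \<open>w (j + m) - w j\<close> up to the sign of the block.\<close>

lemma ussr_run_Some_iff:
  fixes w :: "nat \<Rightarrow> int"
  assumes "\<forall>j<k. u j = w (Suc j) - w j" and "j \<le> k"
  shows "ussr_run u k F (Some (s, j)) c V xs \<longleftrightarrow>
    (\<exists>m ys. xs = replicate m True @ False # ys \<and> 0 < j + m \<and> j + m \<le> k \<and>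
       ussr_run u k F None c (V + (if s then 1 else - 1) * (w (j + m) - w j)) ys)"
  using assms(2)
proof (induction xs arbitrary: j V)
  case Nil
  then show ?case by simp
next
  case (Cons b xs)
  show ?case
  proof (cases b)
    case False
    have "b # xs = replicate m True @ False # ys \<longleftrightarrow> m = 0 \<and> ys = xs" for m ys
      using False by (cases m) auto
    then show ?thesis using False Cons.prems by auto
  next
    case True
    have split: "(\<exists>m ys. b # xs = replicate m True @ False # ys \<and> P m ys) \<longleftrightarrow>
        (\<exists>m ys. xs = replicate m True @ False # ys \<and> P (Suc m) ys)" for P
    proof
      assume "\<exists>m ys. b # xs = replicate m True @ False # ys \<and> P m ys"
      then obtain m ys where m: "b # xs = replicate m True @ False # ys" "P m ys" by blast
      with True obtain m' where "m = Suc m'" by (cases m) auto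
      with m show "\<exists>m ys. xs = replicate m True @ False # ys \<and> P (Suc m) ys" by auto
    next
      assume "\<exists>m ys. xs = replicate m True @ False # ys \<and> P (Suc m) ys"
      then obtain m ys where "xs = replicate m True @ False # ys" "P (Suc m) ys" by blast
      then have "b # xs = replicate (Suc m) True @ False # ys \<and> P (Suc m) ys" using True by simp
      then show "\<exists>m ys. b # xs = replicate m True @ False # ys \<and> P m ys" by blast
    qed
    show ?thesis
    proof (cases "j < k")
      case False
      then show ?thesis using True Cons.prems unfolding split by auto
    next
      case jk: True
      then have "Suc j \<le> k" by simp
      have "V + (if s then 1 else - 1) * u j + (if s then 1 else - 1) * (w (j + Suc m) - w (Suc j)) =
          V + (if s then 1 else - 1) * (w (j + Suc m) - w j)" for m
        using assms(1) jk by (simp add: algebra_simps)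
      note IH = Cons.IH[OF \<open>Suc j \<le> k\<close>, of "V + (if s then 1 else - 1) * u j",
          unfolded add_Suc_shift this]
      show ?thesis
        unfolding split using True jk IH by (simp only: ussr_run.simps simp_thms)
    qed
  qed
qed

text \<open>With \<open>w 0 = 0\<close> a whole block of length \<open>a\<close> contributes the
  signed weight \<open>w a\<close>. Lists of pairs suit the induction over the blocks;
  \<open>ussr_run_iff\<close> translates them into the indexed form of an instance.\<close>

lemma ussr_run_None_iff:
  fixes w :: "nat \<Rightarrow> int"
  assumes u: "\<forall>j<k. u j = w (Suc j) - w j" and w0: "w 0 = 0"
  shows "ussr_run u k F None c V xs \<longleftrightarrow>
    (\<exists>ds. length ds = c \<and> (\<forall>(s, a)\<in>set ds. 1 \<le> a \<and> a \<le> k) \<and>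
       xs = concat (map (\<lambda>(s, a). [s] @ replicate a True @ [False]) ds) \<and>
       F (V + (\<Sum>(s, a)\<leftarrow>ds. (if s then 1 else - 1) * w a)))"
proof (induction c arbitrary: V xs)
  case 0
  then show ?case by (cases xs) auto
next
  case (Suc c)
  have Some_iff: "ussr_run u k F (Some (s, 0)) c V ys \<longleftrightarrow>
      (\<exists>m zs. ys = replicate m True @ False # zs \<and> 1 \<le> m \<and> m \<le> k \<and>
         ussr_run u k F None c (V + (if s then 1 else - 1) * w m) zs)" for s ys
    using ussr_run_Some_iff[OF u, of 0 F s c V ys] w0 by (simp add: Suc_le_eq)
  show ?case (is "_ \<longleftrightarrow> (\<exists>ds. ?P ds)")
  proof
    assume "ussr_run u k F None (Suc c) V xs"
    then obtain s ys where xs: "xs = s # ys" and "ussr_run u k F (Some (s, 0)) c V ys"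
      by (cases xs) auto
    then obtain m zs where ys: "ys = replicate m True @ False # zs" and m: "1 \<le> m" "m \<le> k"
      and "ussr_run u k F None c (V + (if s then 1 else - 1) * w m) zs"
      unfolding Some_iff by blast
    then obtain ds where "length ds = c" "\<forall>(s, a)\<in>set ds. 1 \<le> a \<and> a \<le> k"
      "zs = concat (map (\<lambda>(s, a). [s] @ replicate a True @ [False]) ds)"
      "F (V + (if s then 1 else - 1) * w m + (\<Sum>(s, a)\<leftarrow>ds. (if s then 1 else - 1) * w a))"
      unfolding Suc.IH by blast
    then have "?P ((s, m) # ds)" using xs ys m by (simp add: add.assoc)
    then show "\<exists>ds. ?P ds" ..
  next
    assume "\<exists>ds. ?P ds"
    then obtain ds where ds: "?P ds" ..
    then obtain s m ds' where ds': "ds = (s, m) # ds'" by (cases ds) auto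
    let ?zs = "concat (map (\<lambda>(s, a). [s] @ replicate a True @ [False]) ds')"
    have "ussr_run u k F None c (V + (if s then 1 else - 1) * w m) ?zs"
      unfolding Suc.IH using ds ds' by (intro exI[of _ ds']) (simp add: add.assoc)
    moreover have "xs = s # replicate m True @ False # ?zs" "1 \<le> m" "m \<le> k"
      using ds ds' by auto
    ultimately have "ussr_run u k F (Some (s, 0)) c V (replicate m True @ False # ?zs)"
      unfolding Some_iff by blast
    with \<open>xs = _\<close> show "ussr_run u k F None (Suc c) V xs" by simp
  qed
qed

lemma ussr_run_iff:
  fixes w :: "nat \<Rightarrow> int"
  assumes u: "\<forall>j<k. u j = w (Suc j) - w j" and w0: "w 0 = 0"
  shows "ussr_run u k F None k 0 xs \<longleftrightarrow>
    (\<exists>a \<delta>. (\<forall>i\<in>{1..k}. 1 \<le> a i \<and> a i \<le> k \<and> \<delta> i \<in> {-1, 1 :: int}) \<and>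
       xs = concat (map (\<lambda>i. [\<delta> i = 1] @ replicate (a i) True @ [False]) [1..<Suc k]) \<and>
       F (\<Sum>i = 1..k. \<delta> i * w (a i)))" (is "_ \<longleftrightarrow> (\<exists>a \<delta>. ?Q a \<delta>)")
proof -
  have sum: "(\<Sum>i = 1..k. f i) = (\<Sum>i\<leftarrow>[1..<Suc k]. f i)" for f :: "nat \<Rightarrow> int"
    by (simp add: interv_sum_list_conv_sum_set_nat atLeastLessThanSuc_atLeastAtMost del: upt_Suc)
  note ussr_run_ds = ussr_run_None_iff[where u = u and w = w and k = k, OF u w0]
  show ?thesis
  proof
    assume "ussr_run u k F None k 0 xs"
    then obtain ds where len: "length ds = k" and ran: "\<forall>(s, a)\<in>set ds. 1 \<le> a \<and> a \<le> k"
      and xs: "xs = concat (map (\<lambda>(s, a). [s] @ replicate a True @ [False]) ds)"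
      and F: "F (\<Sum>(s, a)\<leftarrow>ds. (if s then 1 else - 1) * w a)"
      unfolding ussr_run_ds add_0 by blast
    \<comment> \<open>Instances are indexed from \<open>1\<close>, lists from
      \<open>0\<close>.\<close>
    define a where "a i = snd (ds ! (i - 1))" for i
    define \<delta> :: "nat \<Rightarrow> int" where "\<delta> i = (if fst (ds ! (i - 1)) then 1 else - 1)" for i
    have ds: "ds = map (\<lambda>i. (\<delta> i = 1, a i)) [1..<Suc k]"
      by (rule nth_equalityI) (auto simp: len a_def \<delta>_def prod_eq_iff simp del: upt_Suc)
    have "(\<Sum>(s, a)\<leftarrow>ds. (if s then 1 else - 1) * w a) = (\<Sum>i\<leftarrow>[1..<Suc k]. \<delta> i * w (a i))"
      unfolding ds map_map
      by (rule arg_cong[where f = sum_list], rule map_cong) (auto simp: \<delta>_def)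
    moreover have "xs = concat (map (\<lambda>i. [\<delta> i = 1] @ replicate (a i) True @ [False]) [1..<Suc k])"
      unfolding xs by (subst ds) (simp add: o_def del: upt_Suc)
    moreover have "1 \<le> a i \<and> a i \<le> k \<and> \<delta> i \<in> {-1, 1}" if "i \<in> {1..k}" for i
    proof -
      have "ds ! (i - 1) \<in> set ds" using that len by (intro nth_mem) auto
      with ran have "1 \<le> snd (ds ! (i - 1)) \<and> snd (ds ! (i - 1)) \<le> k"
        by (metis (no_types, lifting) case_prodD prod.collapse)
      then show ?thesis by (simp add: a_def \<delta>_def)
    qed
    ultimately have "?Q a \<delta>" using F unfolding sum by simp
    then show "\<exists>a \<delta>. ?Q a \<delta>" by blast
  next
    assume "\<exists>a \<delta>. ?Q a \<delta>"
    then obtain a \<delta> where Q: "?Q a \<delta>" by blast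
    let ?ds = "map (\<lambda>i. (\<delta> i = 1, a i)) [1..<Suc k]"
    have "(\<Sum>(s, a)\<leftarrow>?ds. (if s then 1 else - 1) * w a) = (\<Sum>i\<leftarrow>[1..<Suc k]. \<delta> i * w (a i))"
      unfolding map_map
    proof (intro arg_cong[where f = sum_list] map_cong refl)
      fix i assume "i \<in> set [1..<Suc k]"
      then have "i \<in> {1..k}" by auto
      with Q have "\<delta> i = - 1 \<or> \<delta> i = 1" by blast
      then show "((\<lambda>(s, a). (if s then 1 else - 1) * w a) \<circ> (\<lambda>i. (\<delta> i = 1, a i))) i = \<delta> i * w (a i)"
        by auto
    qed
    then have "F (0 + (\<Sum>(s, a)\<leftarrow>?ds. (if s then 1 else - 1) * w a))"
      using Q unfolding sum by simp
    moreover have "length ?ds = k" by (simp del: upt_Suc)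
    moreover have "\<forall>(s, a)\<in>set ?ds. 1 \<le> a \<and> a \<le> k" using Q by (auto simp del: upt_Suc)
    moreover have "xs = concat (map (\<lambda>(s, a). [s] @ replicate a True @ [False]) ?ds)"
      using Q by (simp add: o_def del: upt_Suc)
    ultimately show "ussr_run u k F None k 0 xs" unfolding ussr_run_ds by blast
  qed
qed

section \<open>The sign bit and the construction of the advice\<close>

text \<open>This is the sign bit of two's complement. Storing \<open>- V\<close> instead of
  \<open>V\<close> makes strict positivity readable from one bit, as \<open>V = 0\<close> leaves it
  unset.\<close>

lemma top_bit_of_minus_iff_pos:
  fixes V :: int
  assumes "\<bar>V\<bar> < 2 ^ (L - 1)" "L > 0"
  shows "2 ^ (L - 1) \<le> (- V) mod 2 ^ L \<longleftrightarrow> V > 0"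
proof -
  have L: "2 ^ L = 2 * (2 ^ (L - 1) :: int)" using assms(2) by (cases L) auto
  show ?thesis
  proof (cases "V > 0")
    case True
    have "(- V) mod 2 ^ L = (- V + 2 ^ L) mod 2 ^ L" by simp
    also have "\<dots> = - V + 2 ^ L" using True assms(1) L by (intro mod_pos_pos_trivial) auto
    finally show ?thesis using True assms(1) L by simp
  next
    case False
    then have "(- V) mod 2 ^ L = - V" using assms(1) L by (intro mod_pos_pos_trivial) auto
    then show ?thesis using False assms(1) by simp
  qed
qed

text \<open>A sum of at most \<open>n\<close> weights stays below
  \<open>2 ^ n * 2 ^ sqrt_weight_bits n\<close>; the last digit is the sign bit.\<close>

definition ussr_width :: "nat \<Rightarrow> nat" where
  "ussr_width n = sqrt_weight_bits n + n + 1"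

definition ussr_advice :: "nat \<Rightarrow> bool list list \<Rightarrow> bool" where
  "ussr_advice n us \<longleftrightarrow> length us = n \<and> (\<forall>bs\<in>set us. length bs = ussr_width n) \<and>
    (\<forall>x. length x = n \<longrightarrow>
       ((\<exists>k rest. x = replicate k True @ False # rest \<and>
          ussr_run (\<lambda>j. bits_val (us ! j)) k
            (\<lambda>V. 2 ^ (ussr_width n - 1) \<le> (- V) mod 2 ^ ussr_width n) None k 0 rest)
        \<longleftrightarrow> x \<in> USSR))"

lemma ussr_advice_exists: "\<exists>us. ussr_advice n us"
proof (rule integer_sqrt_weights[of n])
  fix w :: "nat \<Rightarrow> nat"
  assume w0: "w 0 = 0"
    and mono: "\<And>i. i < n \<Longrightarrow> w i \<le> w (Suc i)"
    and bnd: "\<And>i. i \<le> n \<Longrightarrow> w i < 2 ^ sqrt_weight_bits n"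
    and sgn: "\<And>k a \<delta>. k \<le> n \<Longrightarrow> (\<And>i. i \<in> {1..k} \<Longrightarrow> a i \<le> n \<and> \<delta> i \<in> {-1, 1}) \<Longrightarrow>
           (\<Sum>i = 1..k. \<delta> i * int (w (a i))) > 0 \<longleftrightarrow>
           (\<Sum>i = 1..k. real_of_int (\<delta> i) * sqrt (real (a i))) > 0"
  define L where "L = ussr_width n"
  define F where "F V \<longleftrightarrow> 2 ^ (L - 1) \<le> (- V) mod 2 ^ L" for V :: int
  define us where "us = map (\<lambda>j. map (bit (int (w (Suc j)) - int (w j))) [0..<L]) [0..<n]"
  define u where "u j = bits_val (us ! j)" for j
  \<comment> \<open>By monotonicity the increments are nonnegative, and they lie below
    \<open>2 ^ L\<close>, so cutting them to \<open>L\<close> binary digits loses nothing.\<close>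
  have u: "u j = int (w (Suc j)) - int (w j)" if "j < n" for j
  proof -
    have "int (w (Suc j)) < int (2 ^ sqrt_weight_bits n)"
      unfolding of_nat_less_iff using that by (intro bnd) simp
    then have "int (w (Suc j)) - int (w j) < 2 ^ sqrt_weight_bits n"
      unfolding of_nat_power of_nat_numeral by linarith
    also have "\<dots> \<le> 2 ^ L" by (intro power_increasing) (auto simp: L_def ussr_width_def)
    finally have "take_bit L (int (w (Suc j)) - int (w j)) = int (w (Suc j)) - int (w j)"
      using mono[OF that] by (simp add: take_bit_int_eq_self)
    then show ?thesis
      using that by (simp add: u_def us_def horner_sum_bit_eq_take_bit)
  qed
  have F: "F (\<Sum>i = 1..k. \<delta> i * int (w (a i))) \<longleftrightarrow>
      (\<Sum>i = 1..k. real_of_int (\<delta> i) * sqrt (real (a i))) > 0"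
    if k: "k \<le> n" and a: "\<forall>i\<in>{1..k}. 1 \<le> a i \<and> a i \<le> k \<and> \<delta> i \<in> {-1, 1}"
    for k a and \<delta> :: "nat \<Rightarrow> int"
  proof -
    have "\<bar>\<Sum>i = 1..k. \<delta> i * int (w (a i))\<bar> \<le> (\<Sum>i = 1..k. \<bar>\<delta> i\<bar>) * 2 ^ sqrt_weight_bits n"
    proof (rule abs_sum_mult_le)
      fix i assume "i \<in> {1..k}"
      then have "a i \<le> n" using a k by force
      then show "\<bar>int (w (a i))\<bar> \<le> 2 ^ sqrt_weight_bits n"
        using bnd[of "a i"] by (simp add: less_imp_le)
    qed
    also have "(\<Sum>i = 1..k. \<bar>\<delta> i\<bar>) = (\<Sum>i = 1..k. 1)"
      using a by (intro sum.cong refl) fastforce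
    also have "\<dots> * 2 ^ sqrt_weight_bits n \<le> int n * 2 ^ sqrt_weight_bits n"
      using k by (intro mult_right_mono) auto
    also have "\<dots> < 2 ^ n * 2 ^ sqrt_weight_bits n"
      by (intro mult_strict_right_mono of_nat_less_two_power) auto
    also have "\<dots> = 2 ^ (L - 1)" by (simp add: L_def ussr_width_def power_add)
    finally have "F (\<Sum>i = 1..k. \<delta> i * int (w (a i))) \<longleftrightarrow> (\<Sum>i = 1..k. \<delta> i * int (w (a i))) > 0"
      unfolding F_def by (intro top_bit_of_minus_iff_pos) (auto simp: L_def ussr_width_def)
    also have "\<dots> \<longleftrightarrow> (\<Sum>i = 1..k. real_of_int (\<delta> i) * sqrt (real (a i))) > 0"
      using k a by (intro sgn) force+
    finally show ?thesis .
  qed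
  have run: "ussr_run u k F None k 0 rest \<longleftrightarrow>
      (\<exists>a \<delta>. ussr_instance k a \<delta> \<and> replicate k True @ False # rest = ussr_encode k a \<delta> \<and>
         (\<Sum>i = 1..k. real_of_int (\<delta> i) * sqrt (real (a i))) > 0)"
    if "k \<le> n" for k rest
  proof -
    have "ussr_run u k F None k 0 rest \<longleftrightarrow>
      (\<exists>a \<delta>. (\<forall>i\<in>{1..k}. 1 \<le> a i \<and> a i \<le> k \<and> \<delta> i \<in> {-1, 1 :: int}) \<and>
       rest = concat (map (\<lambda>i. [\<delta> i = 1] @ replicate (a i) True @ [False]) [1..<Suc k]) \<and>
       F (\<Sum>i = 1..k. \<delta> i * int (w (a i))))"
      using u that w0 by (intro ussr_run_iff) auto
    also have "\<dots> \<longleftrightarrow> (\<exists>a \<delta>. (\<forall>i\<in>{1..k}. 1 \<le> a i \<and> a i \<le> k \<and> \<delta> i \<in> {-1, 1 :: int}) \<and>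
       rest = concat (map (\<lambda>i. [\<delta> i = 1] @ replicate (a i) True @ [False]) [1..<Suc k]) \<and>
       (\<Sum>i = 1..k. real_of_int (\<delta> i) * sqrt (real (a i))) > 0)"
      using F[OF that] by blast
    \<comment> \<open>For \<open>k = 0\<close> both sides fail: the empty sum is not positive, and
      an instance has \<open>k \<ge> 1\<close>.\<close>
    also have "\<dots> \<longleftrightarrow> (\<exists>a \<delta>. ussr_instance k a \<delta> \<and> replicate k True @ False # rest = ussr_encode k a \<delta> \<and>
         (\<Sum>i = 1..k. real_of_int (\<delta> i) * sqrt (real (a i))) > 0)"
      unfolding ussr_instance_def ussr_encode_def
      by (cases "k = 0") (simp_all add: Suc_le_eq del: upt_Suc)
    finally show ?thesis .
  qed
  have "(\<exists>k rest. x = replicate k True @ False # rest \<and> ussr_run u k F None k 0 rest) \<longleftrightarrow> x \<in> USSR"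
    if x: "length x = n" for x
  proof
    assume "\<exists>k rest. x = replicate k True @ False # rest \<and> ussr_run u k F None k 0 rest"
    then obtain k rest where k: "x = replicate k True @ False # rest" "ussr_run u k F None k 0 rest"
      by blast
    then have "k \<le> n" using x by auto
    from run[OF this] k show "x \<in> USSR" unfolding USSR_def by blast
  next
    assume "x \<in> USSR"
    then obtain k a \<delta> where k: "x = ussr_encode k a \<delta>" "ussr_instance k a \<delta>"
      "(\<Sum>i = 1..k. real_of_int (\<delta> i) * sqrt (real (a i))) > 0"
      unfolding USSR_def by blast
    define rest where
      "rest = concat (map (\<lambda>i. [\<delta> i = 1] @ replicate (a i) True @ [False]) [1..<Suc k])"
    have rest: "x = replicate k True @ False # rest"
      unfolding k(1) ussr_encode_def rest_def by simp
    then have kn: "k \<le> n" using x by auto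
    have "ussr_run u k F None k 0 rest"
      using k unfolding run[OF kn] rest[symmetric] by blast
    with rest show "\<exists>k rest. x = replicate k True @ False # rest \<and> ussr_run u k F None k 0 rest"
      by blast
  qed
  moreover have "length us = n" "\<forall>bs\<in>set us. length bs = L"
    by (auto simp: us_def)
  ultimately have "ussr_advice n us"
    unfolding ussr_advice_def u_def F_def L_def by blast
  then show ?thesis ..
qed

lemma length_concat_advice:
  assumes "\<forall>bs\<in>set us. length bs = L"
  shows "length (concat (map advice_block us)) = length us * (2 * L + 1)"
  using assms by (induction us) auto

theorem theorem1: "USSR \<in> P_poly"
proof -
  obtain us where us: "\<And>n. ussr_advice n (us n)"
    using ussr_advice_exists by metis
  have len: "length (us n) = n" and width: "\<forall>bs\<in>set (us n). length bs = ussr_width n" for n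
    using us[of n] by (simp_all add: ussr_advice_def)
  have run: "(\<exists>k rest. x = replicate k True @ False # rest \<and>
          ussr_run (\<lambda>j. bits_val (us (length x) ! j)) k
            (\<lambda>V. 2 ^ (ussr_width (length x) - 1) \<le> (- V) mod 2 ^ ussr_width (length x))
            None k 0 rest) \<longleftrightarrow> x \<in> USSR" for x
    using us[of "length x"] unfolding ussr_advice_def by blast
  define adv where "adv n = concat (map advice_block (us n))" for n
  \<comment> \<open>\<open>Lp\<close> is the word length as a polynomial in \<open>n\<close>. The
    advice consists of \<open>n\<close> words of \<open>2 * L + 1\<close> bits each, which gives
    \<open>q\<close>, and \<open>p\<close> is the time bound of
    \<open>decides_tm_init\<close>.\<close>
  define Lp :: "nat poly" where "Lp = 2 * [:2, 1:] * [:2, 1:] * [:1, 1:] + [:1, 1:]"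
  define q :: "nat poly" where "q = [:0, 1:] * (2 * Lp + 1)"
  define p :: "nat poly" where "p = (q + [:5, 1:] + 3 * Lp) * [:0, 1:] + [:3, 1:]"
  have L: "poly Lp n = ussr_width n" for n
    by (simp add: Lp_def ussr_width_def sqrt_weight_bits_def algebra_simps)
  have q: "length (adv n) = poly q n" for n
    using length_concat_advice[OF width, of n] by (simp add: adv_def q_def L len)
  have p: "poly p n = (length (adv n) + n + 3 * ussr_width n + 5) * n + n + 3" for n
    unfolding q by (simp add: p_def L algebra_simps)
  have dec: "decides (poly p (length x)) (tm_init ussr_tm x (adv (length x))) (x \<in> USSR)" for x
    using decides_tm_init[OF width[of "length x"], of x] unfolding run p adv_def
    by (simp add: len ussr_width_def)
  have "if x \<in> USSR
      then tm_accepts_within ussr_tm x (adv (length x)) (poly p (length x))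
      else tm_rejects_within ussr_tm x (adv (length x)) (poly p (length x))" for x
    using dec[of x]
    by (auto simp: decides_def tm_accepts_within_def tm_rejects_within_def ussr_tm_def)
  then show ?thesis
    unfolding P_poly_def using wf_ussr_tm eq_imp_le[OF q] by blast
qed

end
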